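(* Let $n \in \mathbb{N}$, $n\ge 1$. The operator $\mathcal{H}_n = \varkappa\Delta + \beta\Delta_0 - b_0\sum_{k=1}^{n}(\Delta_k+\Delta_{-k})$ has an isolated positive eigenvalue if and only if $$\beta > \frac{\varkappa\,(c_1\lambda_1^n + c_2\lambda_2^n) - \frac{\varkappa^2}{2b_0}\,(c_1\lambda_1^{n-1}+c_2\lambda_2^{n-1})}{c_1\lambda_1^n + c_2\lambda_2^n},$$ where $$\lambda_{1} = \frac{(1+\varkappa/b_0) + \sqrt{1+2\varkappa/b_0}}{2},\qquad \lambda_{2} = \frac{(1+\varkappa/b_0) - \sqrt{1+2\varkappa/b_0}}{2},$$ and the constants $c_1,c_2$ are determined by the two linear equations $$c_1\lambda_1 + c_2\lambda_2 = 1 + \frac{\varkappa}{2b_0},\qquad c_1\lambda_1^2+c_2\lambda_2^2 = 1 + \frac{3\varkappa}{2b_0} + \frac{\varkappa^2}{4b_0^2}.$$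
   Context: Here $\varkappa>0$ (walking intensity) and $b_0>0$ (death intensity) are real parameters. The branching intensity is $\beta = f'(1)$, where $f(u)=\sum_{m\ge 0} b_m u^m$, $0\le u\le 1$, with $b_m\ge 0$ for $m\ne 1$, $b_1<0$, $\sum_{m\ge0} b_m=0$; thus $\beta=\beta^*-b_0$, where $\beta^* = \sum_{m>1}(m-1)b_m$ is assumed to be positive and finite. The operators act on $l^2(\mathbb{Z})$. The walking operator is $(\varkappa\Delta\psi)(x) = \frac{\varkappa}{2}(\psi(x+1)+\psi(x-1)) - \varkappa\psi(x)$, $x\in\mathbb{Z}$. For $k\in\mathbb{Z}$, $\Delta_k=\delta_k\delta_k^T$ is the operator of multiplication by the indicator of the point $k$: $(\Delta_k\psi)(x) = \psi(k)$ if $x=k$ and $0$ otherwise. An isolated positive eigenvalue is an eigenvalue $\lambda>0$ that is an isolated point of the spectrum. *)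

theory Defs
  imports "HOL-Analysis.Analysis"
begin

section \<open>The branching law\<close>

text \<open>A branching law is the sequence \<open>b\<close> of coefficients of the infinitesimal generating function.
  Finiteness of \<open>\<beta>\<^sup>*\<close> is the summability condition; without it \<open>suminf\<close> would be a junk value.
  The summands for \<open>m = 0, 1\<close> vanish since \<open>m - 1\<close> is truncated subtraction on naturals.\<close>

definition gen_fun :: "(nat \<Rightarrow> real) \<Rightarrow> real \<Rightarrow> real" where
  "gen_fun b u = (\<Sum>m. b m * u ^ m)"

definition beta_star :: "(nat \<Rightarrow> real) \<Rightarrow> real" where
  "beta_star b = (\<Sum>m. real (m - 1) * b m)"

definition branching_law :: "(nat \<Rightarrow> real) \<Rightarrow> bool" where
  "branching_law b \<longleftrightarrow>
     (\<forall>m. m \<noteq> 1 \<longrightarrow> b m \<ge> 0) \<and> b 1 < 0 \<and> b sums 0 \<and> b 0 > 0 \<and>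
     summable (\<lambda>m. real (m - 1) * b m) \<and> beta_star b > 0"

text \<open>The generating function is only considered on \<open>[0,1]\<close>, so its derivative at \<open>1\<close> is one-sided.\<close>

definition branching_intensity :: "(nat \<Rightarrow> real) \<Rightarrow> real" where
  "branching_intensity b = vector_derivative (gen_fun b) (at 1 within {0..1})"

lemma gen_fun_has_derivative_at_1:
  assumes "branching_law b"
  shows "(gen_fun b has_real_derivative (beta_star b - b 0)) (at 1 within {0..1})"
proof -
  have nn: "b m \<ge> 0" if "m \<noteq> 1" for m
    using assms that by (auto simp: branching_law_def)
  have b0: "b sums 0" and sm: "summable (\<lambda>m. real (m - 1) * b m)"
    using assms by (auto simp: branching_law_def)
  have sb: "(\<lambda>m. real (m - 1) * b m) sums beta_star b"
    using sm by (simp add: beta_star_def summable_sums)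
  have "(\<lambda>m. if m = 0 then b m else 0) sums b 0"
    using sums_single[of 0 b] by simp
  from sums_diff[OF sums_add[OF sb b0] this]
  have "(\<lambda>m. real (m - 1) * b m + b m - (if m = 0 then b m else 0)) sums (beta_star b - b 0)"
    by simp
  moreover have "(\<lambda>m. real (m - 1) * b m + b m - (if m = 0 then b m else 0)) = (\<lambda>m. real m * b m)"
    by (auto simp: fun_eq_iff of_nat_diff algebra_simps)
  ultimately have S: "(\<lambda>m. real m * b m) sums (beta_star b - b 0)"
    by simp
  have "summable (\<lambda>m. \<bar>real m * b m\<bar>)"
  proof (rule summable_comparison_test'[of "\<lambda>m. real m * b m" 2])
    show "summable (\<lambda>m. real m * b m)" using S by (rule sums_summable)
  qed (use nn in \<open>auto simp: abs_mult\<close>)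
  then have unif: "uniform_limit {0..1} (\<lambda>n u. \<Sum>m<n. b m * (real m * u ^ (m - 1)))
               (\<lambda>u. \<Sum>m. b m * (real m * u ^ (m - 1))) sequentially"
  proof (intro Weierstrass_m_test[where M = "\<lambda>m. \<bar>real m * b m\<bar>"])
    fix n and u :: real assume "u \<in> {0..1}"
    then have "\<bar>real n * b n\<bar> * u ^ (n - 1) \<le> \<bar>real n * b n\<bar>" and "0 \<le> u"
      by (auto intro!: mult_left_le power_le_one)
    then show "norm (b n * (real n * u ^ (n - 1))) \<le> \<bar>real n * b n\<bar>"
      by (simp add: abs_mult mult_ac)
  qed
  have der: "((\<lambda>u. b m * u ^ m) has_field_derivative b m * (real m * u ^ (m - 1))) (at u within {0..1})"
    for m u by (auto intro!: derivative_eq_intros)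
  have "summable (\<lambda>m. b m * 1 ^ m)"
    using b0 by (simp add: sums_summable)
  then have "\<exists>g. \<forall>u\<in>{0..1}. (\<lambda>m. b m * u ^ m) sums g u \<and>
      (g has_field_derivative (\<Sum>m. b m * (real m * u ^ (m - 1)))) (at u within {0..1})"
    by (intro has_field_derivative_series[OF _ der unif, of 1]) auto
  then obtain g where g: "\<And>u. u \<in> {0..1} \<Longrightarrow> (\<lambda>m. b m * u ^ m) sums g u \<and>
      (g has_field_derivative (\<Sum>m. b m * (real m * u ^ (m - 1)))) (at u within {0..1})"
    by blast
  have "(g has_field_derivative (beta_star b - b 0)) (at 1 within {0..1})"
    using g[of 1] sums_unique[OF S] by (simp add: mult.commute)
  then show ?thesis
    using has_field_derivative_transform_within[of g _ 1 "{0..1}" 1 "gen_fun b"] g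
    by (auto simp: gen_fun_def sums_iff)
qed

lemma branching_intensity_eq:
  assumes "branching_law b"
  shows "branching_intensity b = beta_star b - b 0"
  unfolding branching_intensity_def
  using gen_fun_has_derivative_at_1[OF assms]
  by (intro vector_derivative_within_cbox[where a = 0 and b = 1, simplified])
     (auto simp: has_real_derivative_iff_has_vector_derivative)


section \<open>Operators on $l^2(\mathbb{Z})$ and their spectra\<close>

text \<open>The Hilbert space is the set \<open>l2\<close> of square-summable complex functions on the integers.
  An operator is a map on all functions of which only the restriction to \<open>l2\<close> matters.\<close>

definition l2 :: "(int \<Rightarrow> complex) set" where
  "l2 = {\<psi>. (\<lambda>x. (cmod (\<psi> x))\<^sup>2) summable_on UNIV}"

definition l2_norm :: "(int \<Rightarrow> complex) \<Rightarrow> real" where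
  "l2_norm \<psi> = sqrt (\<Sum>\<^sub>\<infinity>x. (cmod (\<psi> x))\<^sup>2)"

type_synonym lattice_op = "(int \<Rightarrow> complex) \<Rightarrow> (int \<Rightarrow> complex)"

definition bounded_op :: "lattice_op \<Rightarrow> bool" where
  "bounded_op T \<longleftrightarrow>
     (\<forall>\<psi>\<in>l2. T \<psi> \<in> l2) \<and>
     (\<forall>\<psi>\<in>l2. \<forall>\<phi>\<in>l2. T (\<lambda>x. \<psi> x + \<phi> x) = (\<lambda>x. T \<psi> x + T \<phi> x)) \<and>
     (\<forall>c. \<forall>\<psi>\<in>l2. T (\<lambda>x. c * \<psi> x) = (\<lambda>x. c * T \<psi> x)) \<and>
     (\<exists>C. \<forall>\<psi>\<in>l2. l2_norm (T \<psi>) \<le> C * l2_norm \<psi>)"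

definition resolvent_set :: "lattice_op \<Rightarrow> complex set" where
  "resolvent_set T = {z. \<exists>R. bounded_op R \<and>
     (\<forall>\<psi>\<in>l2. R (\<lambda>x. T \<psi> x - z * \<psi> x) = \<psi> \<and> (\<lambda>x. T (R \<psi>) x - z * R \<psi> x) = \<psi>)}"

definition op_spectrum :: "lattice_op \<Rightarrow> complex set" where
  "op_spectrum T = - resolvent_set T"

definition op_eigenvalue :: "lattice_op \<Rightarrow> complex \<Rightarrow> bool" where
  "op_eigenvalue T z \<longleftrightarrow> (\<exists>\<psi>\<in>l2. \<psi> \<noteq> (\<lambda>x. 0) \<and> T \<psi> = (\<lambda>x. z * \<psi> x))"

definition has_isolated_positive_eigenvalue :: "lattice_op \<Rightarrow> bool" where
  "has_isolated_positive_eigenvalue T \<longleftrightarrow>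
     (\<exists>l::real. l > 0 \<and> op_eigenvalue T (complex_of_real l) \<and>
        complex_of_real l isolated_in op_spectrum T)"


section \<open>The evolution operator\<close>

definition walk_op :: "real \<Rightarrow> lattice_op" where
  "walk_op \<kappa> \<psi> = (\<lambda>x. complex_of_real (\<kappa> / 2) * (\<psi> (x + 1) + \<psi> (x - 1)) - complex_of_real \<kappa> * \<psi> x)"

definition point_op :: "int \<Rightarrow> lattice_op" where
  "point_op k \<psi> = (\<lambda>x. if x = k then \<psi> k else 0)"

definition evolution_op :: "real \<Rightarrow> real \<Rightarrow> real \<Rightarrow> nat \<Rightarrow> lattice_op" where
  "evolution_op \<kappa> \<beta> b0 n \<psi> = (\<lambda>x. walk_op \<kappa> \<psi> x + complex_of_real \<beta> * point_op 0 \<psi> x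
     - complex_of_real b0 * (\<Sum>k=1..n. point_op (int k) \<psi> x + point_op (- int k) \<psi> x))"

end

theory Submission
  imports Defs
begin

text \<open>The operator is a discrete Schroedinger operator whose potential is \<open>-b\<^sub>0\<close> at \<open>1 \<le> \<bar>x\<bar> \<le> n\<close>,
  \<open>\<beta>\<close> at \<open>0\<close> and zero elsewhere. Without the site 0 its potential is nonpositive, hence so is its quadratic
  form. As potentials of finite support are reached by rank-one perturbations of the free walk,
  the spectrum in the right half plane consists of eigenvalues, and the nonpositive form of the
  operator without the site 0 leaves room for only one. A positive eigenvalue is therefore
  automatically isolated, and only its existence is at stake.

  The symmetric solution at energy 0 that is constant outside \<open>[-n, n]\<close> is positive, and
  \<open>c\<^sub>1\<lambda>\<^sub>1\<^sup>k + c\<^sub>2\<lambda>\<^sub>2\<^sup>k\<close> is, up to the factor \<open>(\<kappa>/2b\<^sub>0)\<^sup>k\<close>, its value at distance \<open>k\<close> from the edge.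
  Up to the threshold it is a supersolution, which makes the quadratic form nonpositive. Above it, the
  mismatch at 0 of the solution decaying at infinity at energy \<open>l\<close> changes sign between \<open>l = 0\<close> and
  \<open>l = \<beta>\<close>, and a zero gives an eigenfunction.\<close>

section \<open>The space of square-summable functions\<close>

lemma l2_finite_le:
  assumes "\<psi> \<in> l2" "finite F"
  shows "L2_set (\<lambda>x. cmod (\<psi> x)) F \<le> l2_norm \<psi>"
proof -
  have "(\<Sum>x\<in>F. (cmod (\<psi> x))\<^sup>2) \<le> (\<Sum>\<^sub>\<infinity>x. (cmod (\<psi> x))\<^sup>2)"
    using assms by (intro finite_sum_le_infsum) (auto simp: l2_def)
  then show ?thesis by (simp add: L2_set_def l2_norm_def)
qed

text \<open>A nonnegative series converges once its finite partial sums are bounded. Membership and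
  norm bounds thus reduce to \<open>L2_set\<close> over finite sets, where the Minkowski inequality
  is available.\<close>

lemma l2_boundedI:
  assumes "\<And>F. finite F \<Longrightarrow> L2_set (\<lambda>x. cmod (\<psi> x)) F \<le> C"
  shows "\<psi> \<in> l2" and "l2_norm \<psi> \<le> C"
proof -
  have C: "C \<ge> 0" using assms[of "{}"] by simp
  have le: "(\<Sum>x\<in>F. (cmod (\<psi> x))\<^sup>2) \<le> C\<^sup>2" if "finite F" for F
    using assms[OF that] C by (simp add: L2_set_def sqrt_le_D)
  have s: "(\<lambda>x. (cmod (\<psi> x))\<^sup>2) summable_on UNIV"
    by (rule nonneg_bdd_above_summable_on) (auto intro!: bdd_aboveI le)
  then show "\<psi> \<in> l2" by (simp add: l2_def)
  have "(\<Sum>\<^sub>\<infinity>x. (cmod (\<psi> x))\<^sup>2) \<le> C\<^sup>2"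
    using s le by (intro infsum_le_finite_sums) auto
  then show "l2_norm \<psi> \<le> C"
    unfolding l2_norm_def using C by (metis real_sqrt_le_iff real_sqrt_unique)
qed

lemma l2_norm_nonneg: "l2_norm \<psi> \<ge> 0"
  by (simp add: l2_norm_def infsum_nonneg)

lemma cmod_le_l2_norm: "\<psi> \<in> l2 \<Longrightarrow> cmod (\<psi> k) \<le> l2_norm \<psi>"
  using l2_finite_le[of \<psi> "{k}"] by simp

lemma
  assumes "\<psi> \<in> l2" "\<phi> \<in> l2"
  shows l2_add: "(\<lambda>x. \<psi> x + \<phi> x) \<in> l2"
    and l2_norm_triangle: "l2_norm (\<lambda>x. \<psi> x + \<phi> x) \<le> l2_norm \<psi> + l2_norm \<phi>"
proof -
  have le: "L2_set (\<lambda>x. cmod (\<psi> x + \<phi> x)) F \<le> l2_norm \<psi> + l2_norm \<phi>" if "finite F" for F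
  proof -
    have "L2_set (\<lambda>x. cmod (\<psi> x + \<phi> x)) F \<le> L2_set (\<lambda>x. cmod (\<psi> x) + cmod (\<phi> x)) F"
      by (intro L2_set_mono norm_triangle_ineq norm_ge_zero)
    also have "\<dots> \<le> L2_set (\<lambda>x. cmod (\<psi> x)) F + L2_set (\<lambda>x. cmod (\<phi> x)) F"
      by (rule L2_set_triangle_ineq)
    finally show ?thesis using l2_finite_le[OF assms(1) that] l2_finite_le[OF assms(2) that] by linarith
  qed
  show "(\<lambda>x. \<psi> x + \<phi> x) \<in> l2" "l2_norm (\<lambda>x. \<psi> x + \<phi> x) \<le> l2_norm \<psi> + l2_norm \<phi>"
    using l2_boundedI[OF le] by auto
qed

lemma
  assumes "\<psi> \<in> l2" "\<And>x. cmod (\<phi> x) \<le> C * cmod (\<psi> x)" "C \<ge> 0"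
  shows l2_dominated: "\<phi> \<in> l2" and l2_norm_dominated: "l2_norm \<phi> \<le> C * l2_norm \<psi>"
proof -
  have le: "L2_set (\<lambda>x. cmod (\<phi> x)) F \<le> C * l2_norm \<psi>" if "finite F" for F
  proof -
    have "L2_set (\<lambda>x. cmod (\<phi> x)) F \<le> L2_set (\<lambda>x. C * cmod (\<psi> x)) F"
      by (intro L2_set_mono assms norm_ge_zero)
    also have "\<dots> = C * L2_set (\<lambda>x. cmod (\<psi> x)) F"
      using assms(3) by (simp add: L2_set_right_distrib)
    finally show ?thesis 
      using mult_left_mono[OF l2_finite_le[OF assms(1) that] assms(3)] by linarith
  qed
  show "\<phi> \<in> l2" "l2_norm \<phi> \<le> C * l2_norm \<psi>"
    using l2_boundedI[OF le] by auto
qed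

lemma l2_scale: "\<psi> \<in> l2 \<Longrightarrow> (\<lambda>x. c * \<psi> x) \<in> l2"
  by (rule l2_dominated[where C = "cmod c"]) (auto simp: norm_mult)

lemma l2_norm_scale: "\<psi> \<in> l2 \<Longrightarrow> l2_norm (\<lambda>x. c * \<psi> x) \<le> cmod c * l2_norm \<psi>"
  by (rule l2_norm_dominated) (auto simp: norm_mult)

lemma l2_diff: "\<psi> \<in> l2 \<Longrightarrow> \<phi> \<in> l2 \<Longrightarrow> (\<lambda>x. \<psi> x - \<phi> x) \<in> l2"
  using l2_add[of \<psi> "\<lambda>x. -1 * \<phi> x"] l2_scale[of \<phi> "-1"] by simp

lemma L2_set_shift_le:
  assumes "\<psi> \<in> l2" "finite F"
  shows "L2_set (\<lambda>x. cmod (\<psi> (x + a))) F \<le> l2_norm \<psi>"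
proof -
  have "L2_set (\<lambda>x. cmod (\<psi> (x + a))) F = L2_set (\<lambda>x. cmod (\<psi> x)) ((\<lambda>x. x + a) ` F)"
    by (simp add: L2_set_def sum.reindex)
  then show ?thesis using l2_finite_le[OF assms(1), of "(\<lambda>x. x + a) ` F"] assms(2) by simp
qed

lemma l2_shift: "\<psi> \<in> l2 \<Longrightarrow> (\<lambda>x. \<psi> (x + a)) \<in> l2"
  by (rule l2_boundedI(1)) (rule L2_set_shift_le)

lemma l2_finite_support:
  assumes "finite {x. \<psi> x \<noteq> 0}"
  shows "\<psi> \<in> l2"
proof -
  have "(\<lambda>x. (cmod (\<psi> x))\<^sup>2) summable_on {x. \<psi> x \<noteq> 0}"
    using assms by (rule summable_on_finite)
  then have "(\<lambda>x. (cmod (\<psi> x))\<^sup>2) summable_on UNIV"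
    by (rule summable_on_cong_neutral[THEN iffD1, rotated -1]) auto
  then show ?thesis by (simp add: l2_def)
qed

section \<open>Bounded operators and the free resolvent\<close>

lemma bounded_op_l2: "bounded_op T \<Longrightarrow> \<psi> \<in> l2 \<Longrightarrow> T \<psi> \<in> l2"
  and bounded_op_add: "bounded_op T \<Longrightarrow> \<psi> \<in> l2 \<Longrightarrow> \<phi> \<in> l2 \<Longrightarrow> T (\<lambda>x. \<psi> x + \<phi> x) = (\<lambda>x. T \<psi> x + T \<phi> x)"
  and bounded_op_scale: "bounded_op T \<Longrightarrow> \<psi> \<in> l2 \<Longrightarrow> T (\<lambda>x. c * \<psi> x) = (\<lambda>x. c * T \<psi> x)"
  by (auto simp: bounded_op_def)

lemma bounded_op_normE:
  assumes "bounded_op T"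
  obtains C where "C \<ge> 0" "\<And>\<psi>. \<psi> \<in> l2 \<Longrightarrow> l2_norm (T \<psi>) \<le> C * l2_norm \<psi>"
proof -
  obtain C where C: "\<And>\<psi>. \<psi> \<in> l2 \<Longrightarrow> l2_norm (T \<psi>) \<le> C * l2_norm \<psi>"
    using assms unfolding bounded_op_def by metis
  have "l2_norm (T \<psi>) \<le> \<bar>C\<bar> * l2_norm \<psi>" if "\<psi> \<in> l2" for \<psi>
    using C[OF that] mult_right_mono[OF abs_ge_self[of C] l2_norm_nonneg[of \<psi>]] by linarith
  then show ?thesis using that[of "\<bar>C\<bar>"] by auto
qed

lemma bounded_opI:
  assumes "\<And>\<psi>. \<psi> \<in> l2 \<Longrightarrow> T \<psi> \<in> l2"
    and "\<And>\<psi> \<phi>. \<psi> \<in> l2 \<Longrightarrow> \<phi> \<in> l2 \<Longrightarrow> T (\<lambda>x. \<psi> x + \<phi> x) = (\<lambda>x. T \<psi> x + T \<phi> x)"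
    and "\<And>\<psi> c. \<psi> \<in> l2 \<Longrightarrow> T (\<lambda>x. c * \<psi> x) = (\<lambda>x. c * T \<psi> x)"
    and "\<And>\<psi>. \<psi> \<in> l2 \<Longrightarrow> l2_norm (T \<psi>) \<le> C * l2_norm \<psi>"
  shows "bounded_op T"
  using assms unfolding bounded_op_def by blast

lemma bounded_op_comp:
  assumes "bounded_op S" "bounded_op T"
  shows "bounded_op (\<lambda>\<psi>. S (T \<psi>))"
proof -
  obtain C where C: "C \<ge> 0" "\<And>\<psi>. \<psi> \<in> l2 \<Longrightarrow> l2_norm (S \<psi>) \<le> C * l2_norm \<psi>"
    using bounded_op_normE[OF assms(1)] by blast
  obtain D where D: "D \<ge> 0" "\<And>\<psi>. \<psi> \<in> l2 \<Longrightarrow> l2_norm (T \<psi>) \<le> D * l2_norm \<psi>"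
    using bounded_op_normE[OF assms(2)] by blast
  show ?thesis
  proof (rule bounded_opI[where C = "C * D"])
    fix \<psi> assume \<psi>: "\<psi> \<in> l2"
    have "l2_norm (S (T \<psi>)) \<le> C * l2_norm (T \<psi>)" by (rule C(2)[OF bounded_op_l2[OF assms(2) \<psi>]])
    also have "\<dots> \<le> C * (D * l2_norm \<psi>)" using C(1) D(2)[OF \<psi>] by (rule mult_left_mono[rotated])
    finally show "l2_norm (S (T \<psi>)) \<le> C * D * l2_norm \<psi>" by simp
  qed (simp_all add: bounded_op_l2[OF assms(1)] bounded_op_l2[OF assms(2)] bounded_op_add[OF assms(1)]
      bounded_op_add[OF assms(2)] bounded_op_scale[OF assms(1)] bounded_op_scale[OF assms(2)])
qed

lemma bounded_op_smult:
  assumes "bounded_op T"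
  shows "bounded_op (\<lambda>\<psi> x. c * T \<psi> x)"
proof -
  obtain C where C: "C \<ge> 0" "\<And>\<psi>. \<psi> \<in> l2 \<Longrightarrow> l2_norm (T \<psi>) \<le> C * l2_norm \<psi>"
    using bounded_op_normE[OF assms] by blast
  show ?thesis
  proof (rule bounded_opI[where C = "cmod c * C"])
    fix \<psi> assume \<psi>: "\<psi> \<in> l2"
    have "l2_norm (\<lambda>x. c * T \<psi> x) \<le> cmod c * l2_norm (T \<psi>)"
      by (rule l2_norm_scale[OF bounded_op_l2[OF assms \<psi>]])
    also have "\<dots> \<le> cmod c * (C * l2_norm \<psi>)" using C(2)[OF \<psi>] by (rule mult_left_mono) simp
    finally show "l2_norm (\<lambda>x. c * T \<psi> x) \<le> cmod c * C * l2_norm \<psi>" by simp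
  qed (simp_all add: bounded_op_l2[OF assms] bounded_op_add[OF assms] bounded_op_scale[OF assms]
      l2_scale distrib_left mult.left_commute)
qed

section \<open>Inverting one-sided difference operators\<close>

text \<open>The Neumann series of \<open>one_minus_shift s q\<close>, summed pointwise. It is used
  for \<open>cmod q < 1\<close> with \<open>s = 1\<close> and \<open>s = -1\<close>.\<close>

definition geom_shift :: "int \<Rightarrow> complex \<Rightarrow> lattice_op" where
  "geom_shift s q \<psi> = (\<lambda>x. \<Sum>k. q ^ k * \<psi> (x + s * int k))"

lemma summable_geom_shift:
  assumes "cmod q < 1" "\<psi> \<in> l2"
  shows "summable (\<lambda>k. q ^ k * \<psi> (x + s * int k))"
proof (rule summable_comparison_test')
  show "summable (\<lambda>k. l2_norm \<psi> * cmod q ^ k)"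
    using assms(1) by (intro summable_mult summable_geometric) simp
  show "cmod (q ^ k * \<psi> (x + s * int k)) \<le> l2_norm \<psi> * cmod q ^ k" for k
    using cmod_le_l2_norm[OF assms(2), of "x + s * int k"]
    by (simp add: norm_mult norm_power mult.commute[of "l2_norm \<psi>"] mult_left_mono)
qed

lemma L2_set_sum_le:
  "L2_set (\<lambda>x. cmod (\<Sum>k<N. f k x)) F \<le> (\<Sum>k<(N::nat). L2_set (\<lambda>x. cmod (f k x)) F)"
proof (induction N)
  case (Suc N)
  have "L2_set (\<lambda>x. cmod (\<Sum>k<Suc N. f k x)) F
      \<le> L2_set (\<lambda>x. cmod (\<Sum>k<N. f k x) + cmod (f N x)) F"
    by (intro L2_set_mono) (auto intro: norm_triangle_ineq)
  also have "\<dots> \<le> L2_set (\<lambda>x. cmod (\<Sum>k<N. f k x)) F + L2_set (\<lambda>x. cmod (f N x)) F"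
    by (rule L2_set_triangle_ineq)
  finally show ?case using Suc by simp
qed (simp add: L2_set_def)

text \<open>Translations do not increase the norm, so Minkowski and the geometric series bound every
  partial sum. On a finite set the bound survives the pointwise limit.\<close>

lemma L2_set_geom_shift_le:
  assumes q: "cmod q < 1" and \<psi>: "\<psi> \<in> l2" and F: "finite F"
  shows "L2_set (\<lambda>x. cmod (geom_shift s q \<psi> x)) F \<le> 1 / (1 - cmod q) * l2_norm \<psi>"
proof (rule LIMSEQ_le_const2)
  have "(\<lambda>N. \<Sum>k<N. q ^ k * \<psi> (x + s * int k)) \<longlonglongrightarrow> geom_shift s q \<psi> x" for x
    unfolding geom_shift_def by (rule summable_LIMSEQ[OF summable_geom_shift[OF q \<psi>]])
  then show "(\<lambda>N. L2_set (\<lambda>x. cmod (\<Sum>k<N. q ^ k * \<psi> (x + s * int k))) F)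
      \<longlonglongrightarrow> L2_set (\<lambda>x. cmod (geom_shift s q \<psi> x)) F"
    unfolding L2_set_def by (intro tendsto_intros)
  have "L2_set (\<lambda>x. cmod (\<Sum>k<N. q ^ k * \<psi> (x + s * int k))) F \<le> 1 / (1 - cmod q) * l2_norm \<psi>" for N
  proof -
    have "L2_set (\<lambda>x. cmod (\<Sum>k<N. q ^ k * \<psi> (x + s * int k))) F
        \<le> (\<Sum>k<N. L2_set (\<lambda>x. cmod (q ^ k * \<psi> (x + s * int k))) F)"
      by (rule L2_set_sum_le)
    also have "\<dots> = (\<Sum>k<N. cmod q ^ k * L2_set (\<lambda>x. cmod (\<psi> (x + s * int k))) F)"
      by (simp add: norm_mult norm_power L2_set_right_distrib)
    also have "\<dots> \<le> (\<Sum>k<N. cmod q ^ k * l2_norm \<psi>)"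
      by (intro sum_mono mult_left_mono L2_set_shift_le \<psi> F) simp
    also have "\<dots> = (\<Sum>k<N. cmod q ^ k) * l2_norm \<psi>" by (simp add: sum_distrib_right)
    also have "\<dots> \<le> (\<Sum>k. cmod q ^ k) * l2_norm \<psi>"
      using q by (intro mult_right_mono l2_norm_nonneg sum_le_suminf summable_geometric) auto
    finally show ?thesis using q by (simp add: suminf_geometric)
  qed
  then show "\<exists>N. \<forall>n\<ge>N. L2_set (\<lambda>x. cmod (\<Sum>k<n. q ^ k * \<psi> (x + s * int k))) F
      \<le> 1 / (1 - cmod q) * l2_norm \<psi>" by blast
qed

lemma bounded_op_geom_shift:
  assumes q: "cmod q < 1"
  shows "bounded_op (geom_shift s q)"
proof (rule bounded_opI)
  fix \<psi> \<phi> :: "int \<Rightarrow> complex" and c :: complex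
  assume \<psi>: "\<psi> \<in> l2"
  show "geom_shift s q \<psi> \<in> l2" and "l2_norm (geom_shift s q \<psi>) \<le> 1 / (1 - cmod q) * l2_norm \<psi>"
    by (rule l2_boundedI, rule L2_set_geom_shift_le[OF q \<psi>], assumption)+
  show "geom_shift s q (\<lambda>x. c * \<psi> x) = (\<lambda>x. c * geom_shift s q \<psi> x)"
    using suminf_mult[OF summable_geom_shift[OF q \<psi>]]
    by (simp add: geom_shift_def fun_eq_iff mult.left_commute)
  assume \<phi>: "\<phi> \<in> l2"
  show "geom_shift s q (\<lambda>x. \<psi> x + \<phi> x) = (\<lambda>x. geom_shift s q \<psi> x + geom_shift s q \<phi> x)"
    using suminf_add[OF summable_geom_shift[OF q \<psi>] summable_geom_shift[OF q \<phi>]]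
    by (simp add: geom_shift_def fun_eq_iff distrib_left)
qed

lemma geom_shift_rec:
  assumes "cmod q < 1" "\<psi> \<in> l2"
  shows "geom_shift s q \<psi> x = \<psi> x + q * geom_shift s q \<psi> (x + s)"
proof -
  have "geom_shift s q \<psi> x = \<psi> x + (\<Sum>k. q * (q ^ k * \<psi> (x + s + s * int k)))"
    unfolding geom_shift_def
    using suminf_split_head[OF summable_geom_shift[OF assms, of x s]]
    by (simp add: algebra_simps)
  then show ?thesis
    using suminf_mult[OF summable_geom_shift[OF assms, of "x + s" s], of q] by (simp add: geom_shift_def)
qed

definition one_minus_shift :: "int \<Rightarrow> complex \<Rightarrow> lattice_op" where
  "one_minus_shift s q \<psi> = (\<lambda>x. \<psi> x - q * \<psi> (x + s))"

lemma l2_one_minus_shift: "\<psi> \<in> l2 \<Longrightarrow> one_minus_shift s q \<psi> \<in> l2"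
  unfolding one_minus_shift_def by (rule l2_diff[OF _ l2_scale[OF l2_shift]])

lemma one_minus_shift_geom_shift:
  assumes "cmod q < 1" "\<psi> \<in> l2"
  shows "one_minus_shift s q (geom_shift s q \<psi>) = \<psi>"
  unfolding one_minus_shift_def fun_eq_iff diff_eq_eq by (intro allI geom_shift_rec assms)

text \<open>The series commutes with translation, so the left inverse follows from the same
  recursion as the right inverse.\<close>

lemma geom_shift_one_minus_shift:
  assumes q: "cmod q < 1" and \<psi>: "\<psi> \<in> l2"
  shows "geom_shift s q (one_minus_shift s q \<psi>) = \<psi>"
proof -
  have l: "(\<lambda>x. \<psi> (x + s)) \<in> l2" using \<psi> by (rule l2_shift)
  have "geom_shift s q (one_minus_shift s q \<psi>) = geom_shift s q (\<lambda>x. \<psi> x + (- q) * \<psi> (x + s))"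
    by (simp add: one_minus_shift_def)
  also have "\<dots> = (\<lambda>x. geom_shift s q \<psi> x + (- q) * geom_shift s q (\<lambda>x. \<psi> (x + s)) x)"
    using bounded_op_add[OF bounded_op_geom_shift[OF q] \<psi> l2_scale[OF l, where c = "- q"]]
      bounded_op_scale[OF bounded_op_geom_shift[OF q] l, where c = "- q"] by (simp only:)
  also have "\<dots> = \<psi>"
  proof
    fix x
    have "geom_shift s q (\<lambda>x. \<psi> (x + s)) x = geom_shift s q \<psi> (x + s)"
      by (simp add: geom_shift_def add_ac)
    then show "geom_shift s q \<psi> x + (- q) * geom_shift s q (\<lambda>x. \<psi> (x + s)) x = \<psi> x"
      using geom_shift_rec[OF q \<psi>, of s x] by simp
  qed
  finally show ?thesis .
qed

section \<open>Resolvent of the free walk\<close>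

text \<open>The roots \<open>w + s\<close> and \<open>w - s\<close> have product 1 and sum
  \<open>2 * w\<close>. If neither had modulus below 1, both would have modulus 1, forcing
  \<open>cmod w \<le> 1\<close>.\<close>

lemma ex_decaying_root:
  assumes "Re w > 1"
  obtains q where "cmod q < 1" "q \<noteq> 0" "q\<^sup>2 + 1 = 2 * w * q"
proof -
  define s where "s = csqrt (w\<^sup>2 - 1)"
  have s: "s\<^sup>2 = w\<^sup>2 - 1" by (simp add: s_def)
  have pr: "(w + s) * (w - s) = 1" using s by (simp add: algebra_simps power2_eq_square)
  have "cmod (w + s) < 1 \<or> cmod (w - s) < 1"
  proof (rule ccontr)
    assume "\<not> ?thesis"
    then have ge: "cmod (w + s) \<ge> 1" "cmod (w - s) \<ge> 1" by auto
    have m: "cmod (w + s) * cmod (w - s) = 1" using pr by (metis norm_mult norm_one)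
    have "cmod (w + s) \<le> 1" using mult_left_mono[OF ge(2), of "cmod (w + s)"] m by simp
    moreover have "cmod (w - s) \<le> 1" using mult_right_mono[OF ge(1), of "cmod (w - s)"] m by simp
    ultimately have "cmod ((w + s) + (w - s)) \<le> 2" using norm_triangle_ineq[of "w+s" "w-s"] by linarith
    then have "cmod w \<le> 1" by (simp add: norm_mult flip: mult_2)
    then show False using complex_Re_le_cmod[of w] assms by linarith
  qed
  moreover have "(w + s)\<^sup>2 + 1 = 2 * w * (w + s)" "(w - s)\<^sup>2 + 1 = 2 * w * (w - s)"
    using s by (auto simp: power2_eq_square algebra_simps)
  moreover have "w + s \<noteq> 0" "w - s \<noteq> 0" using pr by auto
  ultimately show ?thesis using that by blast
qed

text \<open>With \<open>q\<close> the decaying solution of the characteristic equation,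
  \<open>walk_op \<kappa> - z\<close> factors into two one-sided difference operators, each inverted
  by its geometric series.\<close>

lemma resolvent_set_walk_op:
  assumes \<kappa>: "\<kappa> > 0" and z: "Re z > 0"
  shows "z \<in> resolvent_set (walk_op \<kappa>)"
proof -
  have "Re (1 + z / of_real \<kappa>) > 1" using assms by simp
  then obtain q where q: "cmod q < 1" "q \<noteq> 0" "q\<^sup>2 + 1 = 2 * (1 + z / of_real \<kappa>) * q"
    by (rule ex_decaying_root)
  \<comment> \<open>Matching the coefficients of the two translations requires
    \<open>- c * q = \<kappa> / 2\<close>; the equation for \<open>q\<close> then makes the diagonal
    agree as well.\<close>
  define c where "c = - (of_real \<kappa> / (2 * q))"
  have c0: "c \<noteq> 0" using q \<kappa> by (simp add: c_def)
  have "z + of_real \<kappa> = of_real \<kappa> * (1 + z / of_real \<kappa>)" using \<kappa> by (simp add: algebra_simps)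
  also have "1 + z / of_real \<kappa> = (q\<^sup>2 + 1) / (2 * q)" using q(2,3) by simp
  finally have z_eq: "z = - c * (q\<^sup>2 + 1) - of_real \<kappa>" by (simp add: c_def eq_diff_eq)
  have \<kappa>_eq: "of_real (\<kappa> / 2) = - c * q" using q(2) by (simp add: c_def)
  have factor: "(\<lambda>x. walk_op \<kappa> \<psi> x - z * \<psi> x)
      = (\<lambda>x. c * one_minus_shift (-1) q (one_minus_shift 1 q \<psi>) x)" for \<psi>
    unfolding z_eq walk_op_def one_minus_shift_def \<kappa>_eq
    by (simp add: fun_eq_iff algebra_simps power2_eq_square)
  define R where "R = (\<lambda>\<psi> x. inverse c * geom_shift 1 q (geom_shift (-1) q \<psi>) x)"
  have gs: "bounded_op (geom_shift s q)" for s using q(1) by (rule bounded_op_geom_shift)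
  have "bounded_op R"
    unfolding R_def by (rule bounded_op_smult[OF bounded_op_comp[OF gs gs]])
  moreover have "R (\<lambda>x. walk_op \<kappa> \<psi> x - z * \<psi> x) = \<psi>" if \<psi>: "\<psi> \<in> l2" for \<psi>
    using c0 q(1) \<psi> unfolding factor R_def
    by (simp add: bounded_op_scale[OF gs] bounded_op_l2[OF gs] l2_one_minus_shift
        geom_shift_one_minus_shift flip: mult.assoc)
  moreover have "(\<lambda>x. walk_op \<kappa> (R \<psi>) x - z * R \<psi> x) = \<psi>" if \<psi>: "\<psi> \<in> l2" for \<psi>
  proof -
    define \<phi> where "\<phi> = geom_shift 1 q (geom_shift (-1) q \<psi>)"
    have "one_minus_shift (-1) q (one_minus_shift 1 q \<phi>) = \<psi>"
      using \<psi> q(1) by (simp add: \<phi>_def one_minus_shift_geom_shift bounded_op_l2[OF gs])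
    moreover have "one_minus_shift (-1) q (one_minus_shift 1 q (R \<psi>)) 
       = (\<lambda>x. inverse c * one_minus_shift (-1) q (one_minus_shift 1 q \<phi>) x)"
      by (simp add: R_def \<phi>_def one_minus_shift_def fun_eq_iff algebra_simps)
    ultimately show ?thesis unfolding factor using c0 by (simp flip: mult.assoc)
  qed
  ultimately show ?thesis unfolding resolvent_set_def by blast
qed

section \<open>Schroedinger operators\<close>

definition schroedinger :: "real \<Rightarrow> (int \<Rightarrow> real) \<Rightarrow> lattice_op" where
  "schroedinger \<kappa> V \<psi> = (\<lambda>x. walk_op \<kappa> \<psi> x + complex_of_real (V x) * \<psi> x)"

lemma l2_bounded_mult:
  assumes "bounded (range V)" "\<psi> \<in> l2"
  shows "(\<lambda>x. complex_of_real (V x) * \<psi> x) \<in> l2"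
proof -
  obtain C where "\<And>x. \<bar>V x\<bar> \<le> C" using assms(1) by (auto simp: bounded_iff)
  moreover from this[of 0] have "C \<ge> 0" by linarith
  ultimately show ?thesis
    by (intro l2_dominated[OF assms(2), of _ C]) (auto simp: norm_mult mult_right_mono)
qed

text \<open>This nesting, with \<open>x + -1\<close> in place of \<open>x - 1\<close>, matches the
  rules for sums, scalings and shifts by \<open>a\<close> literally.\<close>

lemma schroedinger_eq:
  "schroedinger \<kappa> V \<psi> = (\<lambda>x. complex_of_real (\<kappa> / 2) * \<psi> (x + 1)
     + (complex_of_real (\<kappa> / 2) * \<psi> (x + -1) + complex_of_real (V x - \<kappa>) * \<psi> x))"
  by (simp add: schroedinger_def walk_op_def fun_eq_iff algebra_simps)

lemma bounded_range_minus_const: "bounded (range V) \<Longrightarrow> bounded (range (\<lambda>x. V x - (c::real)))"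
  by (auto simp: bounded_minus_comp)

lemma l2_schroedinger:
  assumes "bounded (range V)" "\<psi> \<in> l2"
  shows "schroedinger \<kappa> V \<psi> \<in> l2"
  unfolding schroedinger_eq
  by (rule l2_add[OF l2_scale[OF l2_shift[OF assms(2)]] l2_add[OF l2_scale[OF l2_shift[OF assms(2)]]
        l2_bounded_mult[OF bounded_range_minus_const[OF assms(1)] assms(2)]]])

lemma schroedinger_add:
  "schroedinger \<kappa> V (\<lambda>x. \<psi> x + \<phi> x) = (\<lambda>x. schroedinger \<kappa> V \<psi> x + schroedinger \<kappa> V \<phi> x)"
  by (simp add: schroedinger_eq fun_eq_iff algebra_simps)

lemma schroedinger_scale:
  "schroedinger \<kappa> V (\<lambda>x. c * \<psi> x) = (\<lambda>x. c * schroedinger \<kappa> V \<psi> x)"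
  by (simp add: schroedinger_eq fun_eq_iff algebra_simps)

lemma schroedinger_fun_upd:
  "schroedinger \<kappa> (V(k := c)) \<psi> x
   = schroedinger \<kappa> V \<psi> x + complex_of_real (c - V k) * \<psi> k * (if x = k then 1 else 0)"
  by (simp add: schroedinger_def algebra_simps)

text \<open>A change of the potential at one site is a rank-one perturbation, so the resolvent is updated
  by the Sherman--Morrison formula; its denominator vanishes only at an eigenvalue.\<close>

lemma resolvent_set_fun_upd:
  assumes V: "bounded (range V)" and z: "z \<in> resolvent_set (schroedinger \<kappa> V)"
    and nev: "\<not> op_eigenvalue (schroedinger \<kappa> (V(k := c))) z"
  shows "z \<in> resolvent_set (schroedinger \<kappa> (V(k := c)))"
proof -
  let ?T = "schroedinger \<kappa> V" and ?T' = "schroedinger \<kappa> (V(k := c))"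
  obtain R where R: "bounded_op R"
    and left: "\<And>\<psi>. \<psi> \<in> l2 \<Longrightarrow> R (\<lambda>x. ?T \<psi> x - z * \<psi> x) = \<psi>"
    and right: "\<And>\<psi>. \<psi> \<in> l2 \<Longrightarrow> (\<lambda>x. ?T (R \<psi>) x - z * R \<psi> x) = \<psi>"
    using z unfolding resolvent_set_def by blast
  define d :: complex where "d = complex_of_real (c - V k)"
  define \<delta> :: "int \<Rightarrow> complex" where "\<delta> = (\<lambda>x. if x = k then 1 else 0)"
  have T': "?T' \<psi> x = ?T \<psi> x + d * \<psi> k * \<delta> x" for \<psi> x
    by (simp add: schroedinger_fun_upd d_def \<delta>_def)
  have \<delta>: "\<delta> \<in> l2" by (rule l2_finite_support) (simp add: \<delta>_def)
  \<comment> \<open>The Green function with source at \<open>k\<close>. The perturbed resolvent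
    equation is solved by correcting \<open>R \<psi>\<close> with a multiple of it.\<close>
  define g where "g = R \<delta>"
  have g: "g \<in> l2" unfolding g_def by (rule bounded_op_l2[OF R \<delta>])
  have Tg: "?T g x - z * g x = \<delta> x" for x
    using fun_cong[OF right[OF \<delta>], of x] by (simp add: g_def)
  define D where "D = 1 + d * g k"
  have D: "D \<noteq> 0"
  proof
    assume "D = 0"
    then have dg: "d * g k = - 1" by (simp add: D_def add_eq_0_iff)
    then have "g \<noteq> (\<lambda>x. 0)" by auto
    moreover have "?T' g x = z * g x" for x
    proof -
      have "?T' g x = ?T g x + d * g k * \<delta> x" by (rule T')
      then show ?thesis using Tg[of x] unfolding dg by (simp add: algebra_simps)
    qed
    ultimately have "op_eigenvalue ?T' z" using g unfolding op_eigenvalue_def by blast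
    with nev show False ..
  qed
  define R' where "R' = (\<lambda>\<psi> x. R \<psi> x + (- (d * R \<psi> k / D)) * g x)"
  obtain C where C: "C \<ge> 0" "\<And>\<psi>. \<psi> \<in> l2 \<Longrightarrow> l2_norm (R \<psi>) \<le> C * l2_norm \<psi>"
    using bounded_op_normE[OF R] by blast
  have "bounded_op R'"
  proof (rule bounded_opI[where C = "C + cmod (d / D) * C * l2_norm g"])
    fix \<psi> \<phi> :: "int \<Rightarrow> complex" and a :: complex
    assume \<psi>: "\<psi> \<in> l2"
    note R\<psi> = bounded_op_l2[OF R \<psi>]
    show "R' \<psi> \<in> l2" unfolding R'_def by (rule l2_add[OF R\<psi> l2_scale[OF g]])
    show "R' (\<lambda>x. a * \<psi> x) = (\<lambda>x. a * R' \<psi> x)"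
      unfolding R'_def bounded_op_scale[OF R \<psi>] by (simp add: fun_eq_iff algebra_simps)
    have "l2_norm (R' \<psi>) \<le> l2_norm (R \<psi>) + l2_norm (\<lambda>x. (- (d * R \<psi> k / D)) * g x)"
      unfolding R'_def by (rule l2_norm_triangle[OF R\<psi> l2_scale[OF g]])
    also have "\<dots> \<le> l2_norm (R \<psi>) + cmod (- (d * R \<psi> k / D)) * l2_norm g"
      by (rule add_left_mono[OF l2_norm_scale[OF g]])
    also have "\<dots> = l2_norm (R \<psi>) + cmod (d / D) * cmod (R \<psi> k) * l2_norm g"
      by (simp add: norm_mult norm_divide)
    also have "\<dots> \<le> C * l2_norm \<psi> + cmod (d / D) * (C * l2_norm \<psi>) * l2_norm g"
      using C(2)[OF \<psi>] cmod_le_l2_norm[OF R\<psi>, of k]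
      \<comment> \<open>Evaluation at \<open>k\<close> is bounded by the norm, which controls the
        coefficient of the rank-one correction.\<close>
      by (intro add_mono mult_right_mono mult_left_mono) (auto simp: l2_norm_nonneg)
    finally show "l2_norm (R' \<psi>) \<le> (C + cmod (d / D) * C * l2_norm g) * l2_norm \<psi>"
      by (simp add: algebra_simps)
    assume \<phi>: "\<phi> \<in> l2"
    show "R' (\<lambda>x. \<psi> x + \<phi> x) = (\<lambda>x. R' \<psi> x + R' \<phi> x)"
      unfolding R'_def bounded_op_add[OF R \<psi> \<phi>]
      by (simp add: fun_eq_iff algebra_simps add_divide_distrib)
  qed
  moreover have "R' (\<lambda>x. ?T' \<psi> x - z * \<psi> x) = \<psi>" if \<psi>: "\<psi> \<in> l2" for \<psi>
  proof -
    define \<phi> where "\<phi> = (\<lambda>x. ?T \<psi> x - z * \<psi> x)"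
    have \<phi>: "\<phi> \<in> l2" unfolding \<phi>_def by (rule l2_diff[OF l2_schroedinger[OF V \<psi>] l2_scale[OF \<psi>]])
    have "(\<lambda>x. ?T' \<psi> x - z * \<psi> x) = (\<lambda>x. \<phi> x + (d * \<psi> k) * \<delta> x)"
      by (simp add: T' \<phi>_def fun_eq_iff)
    then have "R (\<lambda>x. ?T' \<psi> x - z * \<psi> x) = (\<lambda>x. \<psi> x + (d * \<psi> k) * g x)"
      using bounded_op_add[OF R \<phi> l2_scale[OF \<delta>, of "d * \<psi> k"]] bounded_op_scale[OF R \<delta>, of "d * \<psi> k"]
        left[OF \<psi>] by (simp add: \<phi>_def g_def)
    moreover have "\<psi> k + d * \<psi> k * g k = \<psi> k * D" by (simp add: D_def algebra_simps)
    ultimately show ?thesis using D by (simp add: R'_def)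
  qed
  moreover have "(\<lambda>x. ?T' (R' \<psi>) x - z * R' \<psi> x) = \<psi>" if \<psi>: "\<psi> \<in> l2" for \<psi>
  proof
    fix x
    define t where "t = d * R \<psi> k / D"
    have R': "R' \<psi> = (\<lambda>x. R \<psi> x + (- t) * g x)" by (simp add: R'_def t_def)
    have "?T' (R' \<psi>) x - z * R' \<psi> x
      = (?T (R \<psi>) x - z * R \<psi> x) - t * (?T g x - z * g x) + d * (R \<psi> k - t * g k) * \<delta> x"
      unfolding R' T' schroedinger_add schroedinger_scale by (simp add: algebra_simps)
    also have "\<dots> = \<psi> x + (d * R \<psi> k - t * D) * \<delta> x"
      using fun_cong[OF right[OF \<psi>], of x] by (simp add: Tg D_def algebra_simps)
    also have "t * D = d * R \<psi> k" using D by (simp add: t_def)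
    finally show "?T' (R' \<psi>) x - z * R' \<psi> x = \<psi> x"
      by (simp only: diff_self mult_zero_left add_0_right)
  qed
  ultimately show ?thesis unfolding resolvent_set_def by blast
qed

section \<open>Quadratic forms\<close>

definition l2_inner :: "(int \<Rightarrow> complex) \<Rightarrow> (int \<Rightarrow> complex) \<Rightarrow> complex" where
  "l2_inner \<psi> \<phi> = (\<Sum>\<^sub>\<infinity>x. \<psi> x * cnj (\<phi> x))"

lemma l2_inner_summable:
  assumes "\<psi> \<in> l2" "\<phi> \<in> l2"
  shows "(\<lambda>x. \<psi> x * cnj (\<phi> x)) summable_on UNIV"
proof (rule abs_summable_summable[OF Infinite_Sum.abs_summable_on_comparison_test'])
  show "(\<lambda>x. (cmod (\<psi> x))\<^sup>2 + (cmod (\<phi> x))\<^sup>2) summable_on UNIV"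
    using assms by (intro summable_on_add) (auto simp: l2_def)
  have "a * b \<le> a\<^sup>2 + b\<^sup>2" for a b :: real
    using sum_squares_bound[of a b, unfolded mult.assoc] zero_le_power2[of a] zero_le_power2[of b]
    by linarith
  then show "cmod (\<psi> x * cnj (\<phi> x)) \<le> (cmod (\<psi> x))\<^sup>2 + (cmod (\<phi> x))\<^sup>2" for x
    by (simp add: norm_mult)
qed

lemma l2_inner_add_left:
  assumes "\<psi> \<in> l2" "\<psi>' \<in> l2" "\<phi> \<in> l2"
  shows "l2_inner (\<lambda>x. \<psi> x + \<psi>' x) \<phi> = l2_inner \<psi> \<phi> + l2_inner \<psi>' \<phi>"
  using infsum_add[OF l2_inner_summable[OF assms(1,3)] l2_inner_summable[OF assms(2,3)]]
  by (simp add: l2_inner_def distrib_right)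

lemma l2_inner_scale_left: "l2_inner (\<lambda>x. c * \<psi> x) \<phi> = c * l2_inner \<psi> \<phi>"
  by (simp add: l2_inner_def infsum_cmult_right' mult.assoc)

lemma l2_inner_commute: "l2_inner \<psi> \<phi> = cnj (l2_inner \<phi> \<psi>)"
  by (simp add: l2_inner_def mult.commute flip: infsum_cnj)

lemma l2_inner_add_right:
  assumes "\<psi> \<in> l2" "\<psi>' \<in> l2" "\<phi> \<in> l2"
  shows "l2_inner \<phi> (\<lambda>x. \<psi> x + \<psi>' x) = l2_inner \<phi> \<psi> + l2_inner \<phi> \<psi>'"
  using l2_inner_add_left[OF assms] by (simp add: l2_inner_commute[of \<phi>])

lemma l2_inner_scale_right: "l2_inner \<psi> (\<lambda>x. c * \<phi> x) = cnj c * l2_inner \<psi> \<phi>"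
  using l2_inner_scale_left[of c \<phi> \<psi>] by (simp add: l2_inner_commute[of \<psi>])

lemma l2_inner_shift: "l2_inner (\<lambda>x. \<psi> (x + a)) \<phi> = l2_inner \<psi> (\<lambda>x. \<phi> (x + - a))"
proof -
  have "bij_betw (\<lambda>x. x + a) UNIV UNIV" by (rule bij_plus_right)
  from infsum_reindex_bij_betw[OF this, of "\<lambda>x. \<psi> x * cnj (\<phi> (x + - a))"]
  show ?thesis by (simp add: l2_inner_def)
qed

lemma l2_inner_self:
  assumes "\<psi> \<in> l2"
  shows "l2_inner \<psi> \<psi> = complex_of_real ((l2_norm \<psi>)\<^sup>2)"
proof -
  have "(\<lambda>x. (cmod (\<psi> x))\<^sup>2) summable_on UNIV" using assms by (simp add: l2_def)
  from infsumI[OF has_sum_of_real[OF has_sum_infsum[OF this], where 'a = complex]]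
  have "l2_inner \<psi> \<psi> = complex_of_real (\<Sum>\<^sub>\<infinity>x. (cmod (\<psi> x))\<^sup>2)"
    by (simp only: l2_inner_def complex_norm_square)
  then show ?thesis by (simp add: l2_norm_def infsum_nonneg)
qed

lemma l2_norm_pos:
  assumes "\<psi> \<in> l2" "\<psi> \<noteq> (\<lambda>x. 0)"
  shows "l2_norm \<psi> > 0"
proof -
  obtain x where "\<psi> x \<noteq> 0" using assms(2) by auto
  then have "0 < cmod (\<psi> x)" by simp
  also have "\<dots> \<le> l2_norm \<psi>" by (rule cmod_le_l2_norm[OF assms(1)])
  finally show ?thesis .
qed

text \<open>The translations by 1 and -1 are adjoint to each other and enter with the same real
  coefficient, while the potential is real.\<close>

lemma l2_inner_schroedinger:
  assumes V: "bounded (range V)" and \<psi>: "\<psi> \<in> l2" and \<phi>: "\<phi> \<in> l2"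
  shows "l2_inner (schroedinger \<kappa> V \<psi>) \<phi> = l2_inner \<psi> (schroedinger \<kappa> V \<phi>)"
proof -
  let ?a = "complex_of_real (\<kappa> / 2)"
  let ?v = "\<lambda>\<psi> x. complex_of_real (V x - \<kappa>) * \<psi> x"
  have v: "?v \<psi> \<in> l2" if "\<psi> \<in> l2" for \<psi>
    by (rule l2_bounded_mult[OF bounded_range_minus_const[OF V] that])
  note s = l2_scale[OF l2_shift]
  have "l2_inner (schroedinger \<kappa> V \<psi>) \<phi>
     = ?a * l2_inner (\<lambda>x. \<psi> (x + 1)) \<phi> + (?a * l2_inner (\<lambda>x. \<psi> (x + -1)) \<phi> + l2_inner (?v \<psi>) \<phi>)"
    unfolding schroedinger_eq
    by (subst l2_inner_add_left[OF s[OF \<psi>] l2_add[OF s[OF \<psi>] v[OF \<psi>]] \<phi>],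
        subst l2_inner_add_left[OF s[OF \<psi>] v[OF \<psi>] \<phi>]) (simp only: l2_inner_scale_left)
  also have "l2_inner (?v \<psi>) \<phi> = l2_inner \<psi> (?v \<phi>)"
    by (simp add: l2_inner_def mult_ac)
  also have "?a * l2_inner (\<lambda>x. \<psi> (x + 1)) \<phi> + (?a * l2_inner (\<lambda>x. \<psi> (x + -1)) \<phi> + l2_inner \<psi> (?v \<phi>))
     = ?a * l2_inner \<psi> (\<lambda>x. \<phi> (x + 1)) + (?a * l2_inner \<psi> (\<lambda>x. \<phi> (x + -1)) + l2_inner \<psi> (?v \<phi>))"
    unfolding l2_inner_shift by simp
  also have "\<dots> = l2_inner \<psi> (schroedinger \<kappa> V \<phi>)"
    unfolding schroedinger_eq
    by (subst l2_inner_add_right[OF s[OF \<phi>] l2_add[OF s[OF \<phi>] v[OF \<phi>]] \<psi>],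
        subst l2_inner_add_right[OF s[OF \<phi>] v[OF \<phi>] \<psi>])
       (simp only: l2_inner_scale_right complex_cnj_complex_of_real)
  finally show ?thesis .
qed

section \<open>Ground state representation of the quadratic form\<close>

lemma infsum_shift: "(\<Sum>\<^sub>\<infinity>x. f (x + a)) = (\<Sum>\<^sub>\<infinity>x::int. f x)"
  by (rule infsum_reindex_bij_betw[OF bij_plus_right])

lemma summable_on_shift: "(\<lambda>x. f (x + a)) summable_on UNIV \<longleftrightarrow> f summable_on (UNIV :: int set)"
  by (rule summable_on_reindex_bij_betw[OF bij_plus_right])

text \<open>Weighted AM-GM with weights from the positive supersolution \<open>\<Phi>\<close> (the ground state representation).\<close>

lemma form_nonpos_if_supersolution:
  assumes V: "bounded (range V)" and \<kappa>: "\<kappa> > 0" and \<psi>: "\<psi> \<in> l2"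
    and pos: "\<And>x. \<Phi> x > 0" and ratio: "\<And>x. \<Phi> (x + 1) \<le> M * \<Phi> x" "\<And>x. \<Phi> (x - 1) \<le> M * \<Phi> x"
    and super: "\<And>x. \<kappa> / 2 * (\<Phi> (x + 1) + \<Phi> (x - 1)) + (V x - \<kappa>) * \<Phi> x \<le> 0"
  shows "Re (l2_inner (schroedinger \<kappa> V \<psi>) \<psi>) \<le> 0"
proof -
  define p where "p = (\<lambda>x. (cmod (\<psi> x))\<^sup>2)"
  \<comment> \<open>\<open>e\<close> and \<open>d\<close> weigh the mass at \<open>x\<close> by the
    ratio of \<open>\<Phi>\<close> at the right and left neighbour to \<open>\<Phi> x\<close>. The
    ratio bound \<open>M\<close> makes both summable.\<close>
  define e where "e = (\<lambda>x. \<Phi> (x + 1) / \<Phi> x * p x)"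
  define d where "d = (\<lambda>x. \<Phi> (x - 1) / \<Phi> x * p x)"
  have p: "p summable_on UNIV" and p0: "p x \<ge> 0" for x using \<psi> by (auto simp: l2_def p_def)
  have M0: "M \<ge> 0" using ratio(1)[of 0] pos[of 0] pos[of 1]
    by (smt (verit) mult_nonpos_nonneg)
  have Mp: "(\<lambda>x. M * p x) summable_on UNIV" using p by (rule summable_on_cmult_right)
  have e: "e summable_on UNIV"
  proof (rule summable_on_comparison_test[OF Mp])
    fix x
    have "\<Phi> (x + 1) / \<Phi> x \<le> M" using ratio(1)[of x] pos[of x] by (simp add: pos_divide_le_eq)
    then show "e x \<le> M * p x" unfolding e_def by (rule mult_right_mono[OF _ p0])
    show "e x \<ge> 0" using pos p0 by (simp add: e_def less_imp_le)
  qed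
  have d: "d summable_on UNIV"
  proof (rule summable_on_comparison_test[OF Mp])
    fix x
    have "\<Phi> (x - 1) / \<Phi> x \<le> M" using ratio(2)[of x] pos[of x] by (simp add: pos_divide_le_eq)
    then show "d x \<le> M * p x" unfolding d_def by (rule mult_right_mono[OF _ p0])
    show "d x \<ge> 0" using pos p0 by (simp add: d_def less_imp_le)
  qed
  have Vp: "(\<lambda>x. (V x - \<kappa>) * p x) summable_on UNIV"
  proof -
    have "(\<lambda>x. Re (complex_of_real (V x - \<kappa>) * \<psi> x * cnj (\<psi> x))) summable_on UNIV"
      by (rule summable_on_Re[OF l2_inner_summable[OF l2_bounded_mult[OF bounded_range_minus_const[OF V] \<psi>] \<psi>]])
    then show ?thesis
      unfolding p_def cmod_power2 by (simp add: power2_eq_square algebra_simps)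
  qed
  have amgm: "Re (\<psi> x * cnj (\<psi> y)) \<le> (\<Phi> x / \<Phi> y * p y + \<Phi> y / \<Phi> x * p x) / 2" for x y
  proof -
    have mean: "a * b \<le> (a\<^sup>2 + b\<^sup>2) / 2" for a b :: real
      using sum_squares_bound[of a b] by simp
    \<comment> \<open>The square of this weight balances the two squares so that they carry exactly
      the ratios appearing in \<open>e\<close> and \<open>d\<close>.\<close>
    define s where "s = sqrt (\<Phi> x / \<Phi> y)"
    have s: "s > 0" "s\<^sup>2 = \<Phi> x / \<Phi> y" using pos by (simp_all add: s_def less_imp_le)
    have "Re (\<psi> x * cnj (\<psi> y)) \<le> cmod (\<psi> x) * cmod (\<psi> y)"
      using complex_Re_le_cmod[of "\<psi> x * cnj (\<psi> y)"] by (simp add: norm_mult)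
    also have "\<dots> = (cmod (\<psi> x) / s) * (s * cmod (\<psi> y))" using s by simp
    also have "\<dots> \<le> ((cmod (\<psi> x) / s)\<^sup>2 + (s * cmod (\<psi> y))\<^sup>2) / 2"
      by (rule mean)
    also have "\<dots> = (\<Phi> x / \<Phi> y * p y + \<Phi> y / \<Phi> x * p x) / 2"
      by (simp add: power_divide power_mult_distrib s p_def)
    finally show ?thesis .
  qed
  \<comment> \<open>A pointwise majorant of the form density. The bond from \<open>x\<close> to
    \<open>x + 1\<close> contributes \<open>e x + d (x + 1)\<close>, the bond to
    \<open>x - 1\<close> contributes \<open>d x + e (x + -1)\<close>.\<close>
  define G where "G = (\<lambda>x. \<kappa> / 4 * (e x + d (x + 1) + (d x + e (x + -1))) + (V x - \<kappa>) * p x)"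
  have e': "(\<lambda>x. e (x + -1)) summable_on UNIV" and d': "(\<lambda>x. d (x + 1)) summable_on UNIV"
    using e d by (simp_all only: summable_on_shift)
  note sums = summable_on_add[OF summable_on_add[OF e d'] summable_on_add[OF d e']]
  have G: "G summable_on UNIV"
    unfolding G_def by (rule summable_on_add[OF summable_on_cmult_right[OF sums] Vp])
  have inner: "(\<lambda>x. schroedinger \<kappa> V \<psi> x * cnj (\<psi> x)) summable_on UNIV"
    by (rule l2_inner_summable[OF l2_schroedinger[OF V \<psi>] \<psi>])
  have "Re (l2_inner (schroedinger \<kappa> V \<psi>) \<psi>) = (\<Sum>\<^sub>\<infinity>x. Re (schroedinger \<kappa> V \<psi> x * cnj (\<psi> x)))"
    unfolding l2_inner_def by (rule infsum_Re[OF inner, symmetric])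
  also have "\<dots> \<le> (\<Sum>\<^sub>\<infinity>x. G x)"
  proof (rule infsum_mono[OF summable_on_Re[OF inner] G])
    fix x
    have "Re (schroedinger \<kappa> V \<psi> x * cnj (\<psi> x))
      = \<kappa> / 2 * (Re (\<psi> (x + 1) * cnj (\<psi> x)) + Re (\<psi> (x + -1) * cnj (\<psi> x))) + (V x - \<kappa>) * p x"
      unfolding schroedinger_eq p_def cmod_power2
      by (simp add: power2_eq_square algebra_simps add_divide_distrib)
    also have "\<dots> \<le> \<kappa> / 2 * ((e x + d (x + 1)) / 2 + (d x + e (x + -1)) / 2) + (V x - \<kappa>) * p x"
      using amgm[of "x + 1" x] amgm[of "x + -1" x] \<kappa>
      by (intro add_right_mono mult_left_mono add_mono) (auto simp: e_def d_def)
    also have "\<dots> = G x" by (simp add: G_def field_simps)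
    finally show "Re (schroedinger \<kappa> V \<psi> x * cnj (\<psi> x)) \<le> G x" .
  qed
  \<comment> \<open>Shifting the summation index moves the weights at neighbouring sites back to
    \<open>x\<close>; the supersolution inequality, multiplied by \<open>p x / \<Phi> x\<close>,
    then applies site by site.\<close>
  also have "(\<Sum>\<^sub>\<infinity>x. G x) = \<kappa> / 4 * ((infsum e UNIV + infsum d UNIV) + (infsum d UNIV + infsum e UNIV))
      + (\<Sum>\<^sub>\<infinity>x. (V x - \<kappa>) * p x)"
    unfolding G_def
    by (subst infsum_add[OF summable_on_cmult_right[OF sums] Vp], subst infsum_cmult_right',
        subst infsum_add[OF summable_on_add[OF e d'] summable_on_add[OF d e']],
        subst infsum_add[OF e d'], subst infsum_add[OF d e']) (simp only: infsum_shift)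
  also have "\<dots> = \<kappa> / 2 * (infsum e UNIV + infsum d UNIV) + (\<Sum>\<^sub>\<infinity>x. (V x - \<kappa>) * p x)"
    by simp
  also have "\<dots> = (\<Sum>\<^sub>\<infinity>x. \<kappa> / 2 * (e x + d x) + (V x - \<kappa>) * p x)"
    by (subst infsum_add[OF summable_on_cmult_right[OF summable_on_add[OF e d]] Vp],
        subst infsum_cmult_right', subst infsum_add[OF e d]) (rule refl)
  also have "\<dots> \<le> 0"
  proof -
    have "\<kappa> / 2 * (e x + d x) + (V x - \<kappa>) * p x \<le> 0" for x
    proof -
      have "\<kappa> / 2 * (e x + d x) + (V x - \<kappa>) * p x
        = (\<kappa> / 2 * (\<Phi> (x + 1) + \<Phi> (x - 1)) + (V x - \<kappa>) * \<Phi> x) * (p x / \<Phi> x)"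
        using pos[of x] by (simp add: e_def d_def field_simps)
      also have "\<dots> \<le> 0" using super[of x] pos[of x] p0[of x] by (intro mult_nonpos_nonneg) auto
      finally show ?thesis .
    qed
    then have "(\<Sum>\<^sub>\<infinity>x. \<kappa> / 2 * (e x + d x) + (V x - \<kappa>) * p x) \<le> (\<Sum>\<^sub>\<infinity>x::int. 0)"
      by (intro infsum_mono summable_on_add[OF summable_on_cmult_right[OF summable_on_add[OF e d]] Vp]) auto
    then show ?thesis by simp
  qed
  finally show ?thesis .
qed

section \<open>The spectrum in the right half plane\<close>

text \<open>A left inverse of \<open>T - z\<close> would have to map 0 to a nonzero
  eigenfunction.\<close>

lemma op_eigenvalue_in_spectrum:
  assumes "op_eigenvalue T z"
  shows "z \<in> op_spectrum T"
proof -
  obtain \<psi> where \<psi>: "\<psi> \<in> l2" "\<psi> \<noteq> (\<lambda>x. 0)" "T \<psi> = (\<lambda>x. z * \<psi> x)"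
    using assms unfolding op_eigenvalue_def by blast
  have False if R: "bounded_op R" and left: "R (\<lambda>x. T \<psi> x - z * \<psi> x) = \<psi>" for R
  proof -
    have "R (\<lambda>x. 0 * \<psi> x) = (\<lambda>x. 0 * R \<psi> x)" by (rule bounded_op_scale[OF R \<psi>(1)])
    then show False using left \<psi> by simp
  qed
  then show ?thesis using \<psi>(1) unfolding op_spectrum_def resolvent_set_def by blast
qed

text \<open>On an eigenfunction the form equals \<open>z\<close> times the squared norm, so its real
  part has the sign of \<open>Re z\<close>, for complex \<open>z\<close> too.\<close>

lemma no_eigenvalue_if_form_nonpos:
  assumes form: "\<And>\<psi>. \<psi> \<in> l2 \<Longrightarrow> Re (l2_inner (T \<psi>) \<psi>) \<le> 0" and z: "Re z > 0"
  shows "\<not> op_eigenvalue T z"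
proof
  assume "op_eigenvalue T z"
  then obtain \<psi> where \<psi>: "\<psi> \<in> l2" "\<psi> \<noteq> (\<lambda>x. 0)" "T \<psi> = (\<lambda>x. z * \<psi> x)"
    unfolding op_eigenvalue_def by blast
  have "Re (l2_inner (T \<psi>) \<psi>) = Re z * (l2_norm \<psi>)\<^sup>2"
    by (simp add: \<psi>(3) l2_inner_scale_left l2_inner_self[OF \<psi>(1)])
  also have "\<dots> > 0" using z l2_norm_pos[OF \<psi>(1,2)] by simp
  finally show False using form[OF \<psi>(1)] by simp
qed

text \<open>The constant 1 is a supersolution.\<close>

lemma form_nonpos_if_potential_nonpos:
  assumes "bounded (range V)" "\<kappa> > 0" "\<And>x. V x \<le> 0" "\<psi> \<in> l2"
  shows "Re (l2_inner (schroedinger \<kappa> V \<psi>) \<psi>) \<le> 0"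
  using assms by (intro form_nonpos_if_supersolution[where \<Phi> = "\<lambda>x. 1" and M = 1]) auto

lemma bounded_range_finite_support:
  fixes V :: "'a \<Rightarrow> real"
  assumes "finite {x. V x \<noteq> 0}"
  shows "bounded (range V)"
proof -
  have "range V \<subseteq> insert 0 (V ` {x. V x \<noteq> 0})" by auto
  then show ?thesis using assms by (meson bounded_subset finite_imageI finite_imp_bounded finite_insert)
qed

text \<open>Starting from the free walk, the potential is built up one site at a time. Every
  intermediate potential is nonpositive, so no eigenvalue obstructs the rank-one update.\<close>

lemma resolvent_set_if_potential_nonpos:
  assumes \<kappa>: "\<kappa> > 0" and z: "Re z > 0" and F: "finite F"
    and V: "\<And>x. V x \<le> 0" "\<And>x. x \<notin> F \<Longrightarrow> V x = 0"
  shows "z \<in> resolvent_set (schroedinger \<kappa> V)"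
  using F V
proof (induction F arbitrary: V rule: finite_induct)
  case empty
  then have "schroedinger \<kappa> V = walk_op \<kappa>" by (simp add: schroedinger_def fun_eq_iff)
  then show ?case using resolvent_set_walk_op[OF \<kappa> z] by simp
next
  case (insert k F)
  have bdd: "bounded (range U)" if "\<And>x. x \<notin> insert k F \<Longrightarrow> U x = 0" for U :: "int \<Rightarrow> real"
    by (rule bounded_range_finite_support, rule finite_subset[of _ "insert k F"])
      (use that insert.hyps in auto)
  have "z \<in> resolvent_set (schroedinger \<kappa> (V(k := 0)))"
    using insert.prems by (intro insert.IH) auto
  moreover have "\<not> op_eigenvalue (schroedinger \<kappa> V) z"
    using insert.prems by (intro no_eigenvalue_if_form_nonpos[OF form_nonpos_if_potential_nonpos[OF bdd \<kappa>] z]) auto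
  moreover have "bounded (range (V(k := 0)))" using insert.prems by (intro bdd) auto
  ultimately show ?case using resolvent_set_fun_upd[of "V(k := 0)" z \<kappa> k "V k"] by simp
qed

text \<open>A function vanishing at 0 does not see the potential there, so the possibly positive
  value at 0 may be replaced by 0.\<close>

lemma form_nonpos_if_vanishing_at_0:
  assumes V: "bounded (range V)" "\<And>x. x \<noteq> 0 \<Longrightarrow> V x \<le> 0" and \<kappa>: "\<kappa> > 0"
    and \<psi>: "\<psi> \<in> l2" "\<psi> 0 = 0"
  shows "Re (l2_inner (schroedinger \<kappa> V \<psi>) \<psi>) \<le> 0"
proof -
  have "range (V(0 := 0)) \<subseteq> insert 0 (range V)" by auto
  then have "bounded (range (V(0 := 0)))" using V(1) by (meson bounded_insert bounded_subset)
  then have "Re (l2_inner (schroedinger \<kappa> (V(0 := 0)) \<psi>) \<psi>) \<le> 0"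
    using V(2) \<kappa> \<psi>(1) by (intro form_nonpos_if_potential_nonpos) auto
  moreover have "schroedinger \<kappa> (V(0 := 0)) \<psi> = schroedinger \<kappa> V \<psi>"
    by (rule ext, subst schroedinger_fun_upd) (simp add: \<psi>(2))
  ultimately show ?thesis by simp
qed

text \<open>If there were two such eigenvalues, a combination of their (orthogonal) eigenfunctions that
  vanishes at 0 would have positive energy.\<close>

lemma eigenvalue_unique:
  assumes V: "bounded (range V)" "\<And>x. x \<noteq> 0 \<Longrightarrow> V x \<le> 0" and \<kappa>: "\<kappa> > 0"
    and z: "op_eigenvalue (schroedinger \<kappa> V) z" "Re z > 0"
    and w: "op_eigenvalue (schroedinger \<kappa> V) w" "Re w > 0"
  shows "z = w"
proof (rule ccontr)
  assume neq: "z \<noteq> w"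
  let ?T = "schroedinger \<kappa> V"
  \<comment> \<open>An eigenfunction of positive energy cannot vanish at 0, so it can be scaled to
    any nonzero value there. The values 1 and -1 below make the sum vanish at 0.\<close>
  have normalized: "\<exists>\<psi>\<in>l2. \<psi> 0 = c \<and> ?T \<psi> = (\<lambda>x. u * \<psi> x) \<and> l2_norm \<psi> > 0"
    if u: "op_eigenvalue ?T u" "Re u > 0" and c: "c \<noteq> 0" for u c
  proof -
    obtain \<psi> where \<psi>: "\<psi> \<in> l2" "\<psi> \<noteq> (\<lambda>x. 0)" "?T \<psi> = (\<lambda>x. u * \<psi> x)"
      using u unfolding op_eigenvalue_def by blast
    have "Re (l2_inner (?T \<psi>) \<psi>) = Re u * (l2_norm \<psi>)\<^sup>2"
      by (simp add: \<psi>(3) l2_inner_scale_left l2_inner_self[OF \<psi>(1)])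
    also have "\<dots> > 0" using u l2_norm_pos[OF \<psi>(1,2)] by simp
    finally have 0: "\<psi> 0 \<noteq> 0" using form_nonpos_if_vanishing_at_0[OF V \<kappa> \<psi>(1)] by force
    define \<phi> where "\<phi> = (\<lambda>x. (c / \<psi> 0) * \<psi> x)"
    have \<phi>: "\<phi> \<in> l2" unfolding \<phi>_def by (rule l2_scale[OF \<psi>(1)])
    have \<phi>0: "\<phi> 0 = c" using 0 by (simp add: \<phi>_def)
    have "?T \<phi> = (\<lambda>x. u * \<phi> x)"
      unfolding \<phi>_def schroedinger_scale \<psi>(3) by (simp add: mult.left_commute)
    moreover have "l2_norm \<phi> > 0" using l2_norm_pos[OF \<phi>] \<phi>0 c by force
    ultimately show ?thesis using \<phi> \<phi>0 by blast
  qed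
  obtain \<psi> where \<psi>: "\<psi> \<in> l2" "\<psi> 0 = 1" "?T \<psi> = (\<lambda>x. z * \<psi> x)" "l2_norm \<psi> > 0"
    using normalized[OF z, of 1] by auto
  obtain \<phi> where \<phi>: "\<phi> \<in> l2" "\<phi> 0 = -1" "?T \<phi> = (\<lambda>x. w * \<phi> x)" "l2_norm \<phi> > 0"
    using normalized[OF w, of "-1"] by auto
  have real: "cnj w = w"
    using l2_inner_schroedinger[OF V(1) \<phi>(1) \<phi>(1), of \<kappa>] \<phi>(4)
    by (simp add: \<phi>(3) l2_inner_scale_left l2_inner_scale_right l2_inner_self[OF \<phi>(1)])
  \<comment> \<open>Symmetry and the reality of \<open>w\<close> give
    \<open>(z - w) * l2_inner \<psi> \<phi> = 0\<close>.\<close>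
  have orth: "l2_inner \<psi> \<phi> = 0"
    using l2_inner_schroedinger[OF V(1) \<psi>(1) \<phi>(1), of \<kappa>] neq
    by (simp add: \<psi>(3) \<phi>(3) l2_inner_scale_left l2_inner_scale_right real)
  then have orth': "l2_inner \<phi> \<psi> = 0" by (subst l2_inner_commute) simp
  define \<eta> where "\<eta> = (\<lambda>x. \<psi> x + \<phi> x)"
  have \<eta>: "\<eta> \<in> l2" "\<eta> 0 = 0" using l2_add[OF \<psi>(1) \<phi>(1)] \<psi>(2) \<phi>(2) by (simp_all add: \<eta>_def)
  have "l2_inner (?T \<eta>) \<eta> = z * l2_inner \<psi> \<eta> + w * l2_inner \<phi> \<eta>"
    unfolding l2_inner_scale_left[symmetric]
    by (subst l2_inner_add_left[OF l2_scale[OF \<psi>(1)] l2_scale[OF \<phi>(1)] \<eta>(1), symmetric])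
       (simp only: \<eta>_def schroedinger_add \<psi>(3) \<phi>(3))
  also have "l2_inner \<psi> \<eta> = complex_of_real ((l2_norm \<psi>)\<^sup>2)"
    unfolding \<eta>_def l2_inner_add_right[OF \<psi>(1) \<phi>(1) \<psi>(1)] by (simp add: orth l2_inner_self[OF \<psi>(1)])
  also have "l2_inner \<phi> \<eta> = complex_of_real ((l2_norm \<phi>)\<^sup>2)"
    unfolding \<eta>_def l2_inner_add_right[OF \<psi>(1) \<phi>(1) \<phi>(1)] by (simp add: orth' l2_inner_self[OF \<phi>(1)])
  finally have "Re (l2_inner (?T \<eta>) \<eta>) = Re z * (l2_norm \<psi>)\<^sup>2 + Re w * (l2_norm \<phi>)\<^sup>2" by simp
  moreover have "Re z * (l2_norm \<psi>)\<^sup>2 > 0" using z(2) \<psi>(4) by simp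
  moreover have "Re w * (l2_norm \<phi>)\<^sup>2 > 0" using w(2) \<phi>(4) by simp
  ultimately show False using form_nonpos_if_vanishing_at_0[OF V \<kappa> \<eta>] by linarith
qed

text \<open>Clearing site 0 leaves a nonpositive potential, whose resolvent set contains the right
  half plane. Restoring the site is a rank-one change, so only eigenvalues can enter, and by
  uniqueness at most one does.\<close>

lemma isolated_positive_eigenvalue_iff:
  assumes F: "finite {x. V x \<noteq> 0}" and V: "\<And>x. x \<noteq> 0 \<Longrightarrow> V x \<le> 0" and \<kappa>: "\<kappa> > 0"
  shows "has_isolated_positive_eigenvalue (schroedinger \<kappa> V)
     \<longleftrightarrow> (\<exists>l>0. op_eigenvalue (schroedinger \<kappa> V) (complex_of_real l))"
proof
  let ?T = "schroedinger \<kappa> V"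
  assume "\<exists>l>0. op_eigenvalue ?T (complex_of_real l)"
  then obtain l where l: "l > 0" "op_eigenvalue ?T (complex_of_real l)" by blast
  have "w = complex_of_real l" if w: "Re w > 0" "w \<in> op_spectrum ?T" for w
  proof -
    have "w \<in> resolvent_set (schroedinger \<kappa> (V(0 := 0)))"
      using V by (intro resolvent_set_if_potential_nonpos[OF \<kappa> w(1) F]) auto
    moreover have "bounded (range (V(0 := 0)))"
      by (rule bounded_range_finite_support, rule finite_subset[OF _ F]) auto
    ultimately have "op_eigenvalue ?T w"
      using resolvent_set_fun_upd[of "V(0 := 0)" w \<kappa> 0 "V 0"] w(2) by (auto simp: op_spectrum_def)
    then show ?thesis
      using eigenvalue_unique[OF bounded_range_finite_support[OF F] V \<kappa> _ w(1) l(2)] l(1) by simp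
  qed
  then have "{w. Re w > 0} \<inter> op_spectrum ?T = {complex_of_real l}"
    using l op_eigenvalue_in_spectrum[OF l(2)] by auto
  \<comment> \<open>The whole half plane serves as the isolating neighbourhood.\<close>
  moreover have "open {w. Re w > 0}" by (rule open_halfspace_Re_gt)
  ultimately have "complex_of_real l isolated_in op_spectrum ?T"
    unfolding isolated_in_def by blast
  then show "has_isolated_positive_eigenvalue ?T"
    using l unfolding has_isolated_positive_eigenvalue_def by blast
qed (auto simp: has_isolated_positive_eigenvalue_def)

section \<open>Existence of a positive eigenvalue\<close>

definition potential :: "real \<Rightarrow> real \<Rightarrow> nat \<Rightarrow> int \<Rightarrow> real" where
  "potential \<beta> b0 n x = (if x = 0 then \<beta> else if \<bar>x\<bar> \<le> int n then - b0 else 0)"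

lemma evolution_op_eq: "evolution_op \<kappa> \<beta> b0 n = schroedinger \<kappa> (potential \<beta> b0 n)"
proof -
  have "(\<Sum>k=1..n. point_op (int k) \<psi> x + point_op (- int k) \<psi> x)
      = (if x \<noteq> 0 \<and> \<bar>x\<bar> \<le> int n then \<psi> x else 0)" for \<psi> x
    by (induction n) (auto simp: point_op_def)
  then show ?thesis
    by (auto simp: fun_eq_iff evolution_op_def schroedinger_def potential_def point_op_def)
qed

text \<open>Going inwards from the endpoints of \<open>[-n, n]\<close>, \<open>wave a q k\<close> is the value at
  distance \<open>k\<close> from them of the solution that continues outwards as \<open>1, q, q\<^sup>2, \<dots>\<close>.\<close>

fun wave :: "real \<Rightarrow> real \<Rightarrow> nat \<Rightarrow> real" where
  "wave a q 0 = 1"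
| "wave a q (Suc 0) = a - q"
| "wave a q (Suc (Suc k)) = a * wave a q (Suc k) - wave a q k"

text \<open>For \<open>a \<ge> 2\<close> the recursion makes increments nondecreasing as long as the
  values are positive, and the first increment \<open>a - q - 1\<close> is nonnegative.\<close>

lemma wave_mono_Suc:
  assumes "a \<ge> 2" "q \<le> 1"
  shows "1 \<le> wave a q k \<and> wave a q k \<le> wave a q (Suc k)"
proof (induction k)
  case (Suc k)
  then have "2 * wave a q (Suc k) \<le> a * wave a q (Suc k)"
    using assms by (intro mult_right_mono) auto
  with Suc show ?case unfolding wave.simps(3) by linarith
qed (use assms in auto)

lemma wave_mono:
  assumes "a \<ge> 2" "q \<le> 1" "j \<le> k"
  shows "wave a q j \<le> wave a q k"
  by (rule lift_Suc_mono_le[of "wave a q", OF conjunct2[OF wave_mono_Suc[OF assms(1,2)]] assms(3)])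

lemma continuous_on_wave:
  assumes "continuous_on S a" "continuous_on S q"
  shows "continuous_on S (\<lambda>l. wave (a l) (q l) k)"
proof (induction k rule: less_induct)
  case (less k)
  consider "k = 0" | "k = 1" | j where "k = Suc (Suc j)" by (metis One_nat_def not0_implies_Suc)
  then show ?case
  proof cases
    case 2
    then show ?thesis using continuous_on_diff[OF assms] by simp
  next
    case 3
    then show ?thesis
      using continuous_on_diff[OF continuous_on_mult[OF assms(1) less[of "Suc j"]] less[of j]] by simp
  qed simp
qed

section \<open>The even solution and its mismatch at the origin\<close>

text \<open>The even solution as a function of the distance \<open>m\<close> from the origin. Since
  \<open>wave\<close> counts inwards from the edge \<open>n\<close>, the index is reversed
  inside.\<close>

definition profile :: "real \<Rightarrow> real \<Rightarrow> nat \<Rightarrow> nat \<Rightarrow> real" where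
  "profile a q n m = (if m \<le> n then wave a q (n - m) else q ^ (m - n))"

text \<open>Inside this is the recursion of \<open>wave\<close>, outside that of a geometric
  sequence. At \<open>m = n\<close> the branches fit together because
  \<open>wave a q 1 = a - q\<close>.\<close>

lemma profile_rec:
  assumes "n \<ge> 1" "m \<ge> 1" "q > 0"
  shows "profile a q n (m + 1) + profile a q n (m - 1)
    = (if m \<le> n then a else q + 1 / q) * profile a q n m"
proof -
  consider "m < n" | "m = n" | "m > n" by linarith
  then show ?thesis
  proof cases
    case 1
    then obtain j where "n = m + Suc j" using less_imp_Suc_add by auto
    moreover obtain i where "m = Suc i" using assms(2) by (cases m) auto
    ultimately show ?thesis by (simp add: profile_def Suc_diff_le)
  next
    case 2
    then show ?thesis using assms by (simp add: profile_def)
  next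
    case 3
    then obtain j where "m = n + Suc j" using less_imp_Suc_add by auto
    then show ?thesis using assms by (auto simp: profile_def field_simps)
  qed
qed

lemma profile_pos:
  assumes "a \<ge> 2" "0 < q" "q \<le> 1"
  shows "profile a q n m > 0"
  using wave_mono_Suc[OF assms(1,3), of "n - m"] assms(2) by (auto simp: profile_def)

text \<open>For \<open>q < 1\<close> this exponential bound gives square-summability; for
  \<open>q = 1\<close> it is the uniform bound \<open>wave a q n\<close>.\<close>

lemma profile_le:
  assumes "a \<ge> 2" "0 < q" "q \<le> 1"
  shows "profile a q n m \<le> wave a q n / q ^ n * q ^ m"
proof (cases "m \<le> n")
  case True
  have w: "1 \<le> wave a q n" using wave_mono_Suc[OF assms(1,3)] by blast
  have "profile a q n m \<le> wave a q n"
    using True wave_mono[OF assms(1,3)] by (simp add: profile_def)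
  also have "\<dots> \<le> wave a q n * (q ^ m / q ^ n)"
  proof -
    have "1 \<le> q ^ m / q ^ n" using power_decreasing[OF True, of q] assms by (simp add: pos_le_divide_eq)
    from mult_left_mono[OF this, of "wave a q n"] w show ?thesis by simp
  qed
  finally show ?thesis by simp
next
  case False
  have w: "1 \<le> wave a q n" using wave_mono_Suc[OF assms(1,3)] by blast
  have "profile a q n m = 1 * (q ^ m / q ^ n)" using False assms by (simp add: profile_def power_diff)
  also have "\<dots> \<le> wave a q n * (q ^ m / q ^ n)" using w assms by (intro mult_right_mono) auto
  finally show ?thesis by simp
qed

text \<open>The choices give \<open>\<kappa> / 2 * a = \<kappa> + l + b0\<close> and
  \<open>\<kappa> / 2 * (q + 1 / q) = \<kappa> + l\<close>, which are the equations at energy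
  \<open>l\<close> inside and outside. Only the origin, where both neighbours are at distance 1,
  leaves a defect.\<close>

lemma schroedinger_profile:
  fixes \<kappa> \<beta> b0 l q :: real and n :: nat
  defines "a \<equiv> 2 * (1 + (b0 + l) / \<kappa>)"
  defines "\<Phi> \<equiv> (\<lambda>x. profile a q n (nat \<bar>x\<bar>))"
  assumes \<kappa>: "\<kappa> > 0" and n: "n \<ge> 1" and q: "q > 0" "q + 1 / q = 2 * (1 + l / \<kappa>)"
  shows "\<kappa> / 2 * (\<Phi> (x + 1) + \<Phi> (x - 1)) + (potential \<beta> b0 n x - \<kappa>) * \<Phi> x - l * \<Phi> x
    = (if x = 0 then \<kappa> * wave a q (n - 1) + (\<beta> - \<kappa> - l) * wave a q n else 0)"
proof (cases "x = 0")
  case True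
  then show ?thesis using n by (simp add: \<Phi>_def profile_def potential_def algebra_simps)
next
  case False
  define m where "m = nat \<bar>x\<bar>"
  have m: "m \<ge> 1" using False by (simp add: m_def)
  \<comment> \<open>Left and right neighbours swap roles for negative \<open>x\<close>; comparing
    unordered pairs covers both signs.\<close>
  have "{nat \<bar>x + 1\<bar>, nat \<bar>x - 1\<bar>} = {m + 1, m - 1}"
    using False unfolding m_def by (cases "x > 0") (auto simp: nat_add_distrib nat_diff_distrib)
  then have "\<Phi> (x + 1) + \<Phi> (x - 1) = profile a q n (m + 1) + profile a q n (m - 1)"
    unfolding \<Phi>_def doubleton_eq_iff by (metis add.commute)
  also have "\<dots> = (if m \<le> n then a else q + 1 / q) * \<Phi> x"
    unfolding profile_rec[OF n m q(1)] by (simp add: \<Phi>_def m_def)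
  finally have eq: "\<Phi> (x + 1) + \<Phi> (x - 1) = (if m \<le> n then a else q + 1 / q) * \<Phi> x" .
  have "\<kappa> / 2 * a = \<kappa> + l + b0" using \<kappa> by (simp add: a_def field_simps)
  moreover have "\<kappa> / 2 * (q + 1 / q) = \<kappa> + l" using \<kappa> unfolding q(2) by (simp add: field_simps)
  moreover have "potential \<beta> b0 n x = (if m \<le> n then - b0 else 0)"
    using False by (auto simp: potential_def m_def)
  ultimately have "\<kappa> / 2 * (if m \<le> n then a else q + 1 / q) = \<kappa> + l - potential \<beta> b0 n x"
    by (simp only: split: if_split) simp
  then have eq': "\<kappa> / 2 * (\<Phi> (x + 1) + \<Phi> (x - 1))
    = (\<kappa> + l - potential \<beta> b0 n x) * \<Phi> x"
    unfolding eq mult.assoc[symmetric] by (rule arg_cong)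
  show ?thesis unfolding eq' using False by (simp add: algebra_simps)
qed

lemma l2_power_abs:
  assumes q: "0 < q" "q < 1"
  shows "(\<lambda>x. complex_of_real (q ^ nat \<bar>x\<bar>)) \<in> l2"
proof -
  define f where "f = (\<lambda>x::int. (q ^ nat \<bar>x\<bar>)\<^sup>2)"
  have "(\<lambda>k. (q\<^sup>2) ^ k) summable_on (UNIV :: nat set)"
    using q by (subst summable_on_UNIV_nonneg_real_iff)
      (auto intro!: summable_geometric simp: power_less_one_iff abs_square_less_1)
  then have "f summable_on (range (\<lambda>k. s * int k))" if "\<bar>s\<bar> = 1" for s
    using that by (subst summable_on_reindex)
      (auto simp: inj_on_def f_def o_def abs_mult mult.commute simp flip: power_mult)
  from this[of 1] this[of "-1"] have "f summable_on (range (\<lambda>k. 1 * int k) \<union> range (\<lambda>k. -1 * int k))"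
    by (intro summable_on_union) auto
  moreover have "range (\<lambda>k. 1 * int k) \<union> range (\<lambda>k. -1 * int k) = UNIV"
  proof -
    have "x \<in> range (\<lambda>k. 1 * int k) \<union> range (\<lambda>k. -1 * int k)" for x
      by (cases x rule: int_cases2) auto
    then show ?thesis by auto
  qed
  ultimately show ?thesis using q by (simp add: l2_def f_def norm_power)
qed

text \<open>The right-hand side is the defect at 0 of the profile at energy 0, where
  \<open>q = 1\<close>. A nonpositive defect yields a bounded positive supersolution; a positive one
  starts an intermediate value argument in the energy.\<close>

lemma positive_eigenvalue_iff:
  fixes \<kappa> \<beta> b0 :: real
  defines "a \<equiv> (\<lambda>l. 2 * (1 + (b0 + l) / \<kappa>))"
  assumes \<kappa>: "\<kappa> > 0" and b0: "b0 > 0" and n: "n \<ge> 1"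
  shows "(\<exists>l>0. op_eigenvalue (schroedinger \<kappa> (potential \<beta> b0 n)) (complex_of_real l))
    \<longleftrightarrow> \<kappa> * wave (a 0) 1 (n - 1) + (\<beta> - \<kappa>) * wave (a 0) 1 n > 0" (is "?ev \<longleftrightarrow> ?G > 0")
proof
  assume ?ev
  show "?G > 0"
  proof (rule ccontr)
    assume "\<not> ?G > 0"
    then have G: "?G \<le> 0" by simp
    have a0: "a 0 \<ge> 2" using \<kappa> b0 by (simp add: a_def)
    define \<Phi> where "\<Phi> = (\<lambda>x::int. profile (a 0) 1 n (nat \<bar>x\<bar>))"
    have ge1: "\<Phi> x \<ge> 1" for x
      using wave_mono_Suc[OF a0, of 1] by (simp add: \<Phi>_def profile_def)
    have le: "\<Phi> x \<le> wave (a 0) 1 n" for x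
      using profile_le[OF a0, of 1] by (simp add: \<Phi>_def)
    have ratio: "\<Phi> y \<le> wave (a 0) 1 n * \<Phi> x" for x y
    proof -
      have "wave (a 0) 1 n * 1 \<le> wave (a 0) 1 n * \<Phi> x"
        using wave_mono_Suc[OF a0, of 1 n] by (intro mult_left_mono ge1) simp
      then show ?thesis using le[of y] by linarith
    qed
    have pos: "\<Phi> x > 0" for x using ge1[of x] by linarith
    have super: "\<kappa> / 2 * (\<Phi> (x + 1) + \<Phi> (x - 1)) + (potential \<beta> b0 n x - \<kappa>) * \<Phi> x \<le> 0" for x
      using schroedinger_profile[OF \<kappa> n, of 1 0 b0 x \<beta>] G by (simp add: a_def \<Phi>_def split: if_splits)
    have "finite {x. potential \<beta> b0 n x \<noteq> 0}"
      by (rule finite_subset[of _ "{- int n..int n}"]) (auto simp: potential_def)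
    note bdd = bounded_range_finite_support[OF this]
    have "Re (l2_inner (schroedinger \<kappa> (potential \<beta> b0 n) \<psi>) \<psi>) \<le> 0" if "\<psi> \<in> l2" for \<psi>
      by (rule form_nonpos_if_supersolution[where \<Phi> = \<Phi> and M = "wave (a 0) 1 n"])
        (rule bdd \<kappa> that pos ratio super)+
    from no_eigenvalue_if_form_nonpos[OF this] \<open>?ev\<close> show False by auto
  qed
next
  assume G: "?G > 0"
  define t where "t = (\<lambda>l. 1 + l / \<kappa>)"
  \<comment> \<open>The smaller root of \<open>q + 1 / q = 2 * t l\<close>, written as the
    reciprocal of the larger one, whose lower bound 1 gives continuity and
    \<open>q l \<le> 1\<close>.\<close>
  define q where "q = (\<lambda>l. 1 / (t l + sqrt ((t l)\<^sup>2 - 1)))"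
  define w where "w = (\<lambda>l k. wave (a l) (q l) k)"
  \<comment> \<open>The defect at the origin at energy \<open>l\<close>; a zero makes the profile an
    exact eigenfunction.\<close>
  define F where "F = (\<lambda>l. \<kappa> * w l (n - 1) + (\<beta> - \<kappa> - l) * w l n)"
  have t1: "t l \<ge> 1" if "l \<ge> 0" for l using that \<kappa> by (simp add: t_def)
  have a2: "a l \<ge> 2" if "l \<ge> 0" for l using that \<kappa> b0 by (simp add: a_def)
  have s0: "sqrt ((t l)\<^sup>2 - 1) \<ge> 0" if "l \<ge> 0" for l using t1[OF that] by simp
  have ge1: "t l + sqrt ((t l)\<^sup>2 - 1) \<ge> 1" if "l \<ge> 0" for l
    using t1[OF that] s0[OF that] by linarith
  have q0: "q l > 0" if "l \<ge> 0" for l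
    unfolding q_def by (rule divide_pos_pos[OF zero_less_one less_le_trans[OF zero_less_one ge1[OF that]]])
  have q1: "q l \<le> 1" if "l \<ge> 0" for l
    unfolding q_def by (rule divide_le_eq_1_pos[THEN iffD2, OF less_le_trans[OF zero_less_one ge1[OF that]] ge1[OF that]])
  have q_less: "q l < 1" if "l > 0" for l
  proof -
    have "t l > 1" using that \<kappa> by (simp add: t_def)
    then have "t l + sqrt ((t l)\<^sup>2 - 1) > 1" using s0[of l] that by linarith
    then show ?thesis by (simp add: q_def)
  qed
  have qt: "q l + 1 / q l = 2 * t l" if "l \<ge> 0" for l
  proof -
    have "(t l - sqrt ((t l)\<^sup>2 - 1)) * (t l + sqrt ((t l)\<^sup>2 - 1)) = 1"
      using t1[OF that] by (simp add: algebra_simps power2_eq_square[symmetric])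
    moreover have "t l + sqrt ((t l)\<^sup>2 - 1) \<noteq> 0" using ge1[OF that] by linarith
    ultimately have "q l = t l - sqrt ((t l)\<^sup>2 - 1)"
      unfolding q_def by (metis nonzero_divide_eq_eq)
    moreover have "1 / q l = t l + sqrt ((t l)\<^sup>2 - 1)" by (simp add: q_def)
    ultimately show ?thesis by simp
  qed
  have w1: "w l k \<ge> 1" and wle: "w l k \<le> w l (Suc k)" if "l \<ge> 0" for l k
    using wave_mono_Suc[OF a2[OF that] q1[OF that]] by (auto simp: w_def)
  have "q 0 = 1" by (simp add: q_def t_def)
  then have F0: "F 0 > 0" using G by (simp add: F_def w_def)
  have \<beta>0: "\<beta> > 0"
  proof -
    have "\<kappa> * w 0 (n - 1) \<le> \<kappa> * w 0 n" using wle[of 0 "n - 1"] n \<kappa> by simp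
    then have "\<beta> * w 0 n > 0" using F0 by (simp add: F_def algebra_simps)
    then show ?thesis using w1[of 0 n] by (simp add: zero_less_mult_iff)
  qed
  \<comment> \<open>At \<open>l = \<beta>\<close> the defect is
    \<open>\<kappa> * (w \<beta> (n - 1) - w \<beta> n)\<close>, which monotonicity makes
    nonpositive.\<close>
  have "\<kappa> * w \<beta> (n - 1) \<le> \<kappa> * w \<beta> n" using wle[of \<beta> "n - 1"] n \<kappa> \<beta>0 by simp
  then have F\<beta>: "F \<beta> \<le> 0" by (simp add: F_def)
  have cont: "continuous_on {0..\<beta>} F"
  proof -
    have "continuous_on {0..\<beta>} a" and t: "continuous_on {0..\<beta>} t"
      unfolding a_def t_def using \<kappa> by (auto intro!: continuous_intros)
    moreover have "continuous_on {0..\<beta>} (\<lambda>l. t l + sqrt ((t l)\<^sup>2 - 1))"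
      by (intro continuous_on_add continuous_on_real_sqrt continuous_on_diff continuous_on_power
          continuous_on_const t)
    then have "continuous_on {0..\<beta>} q"
      unfolding q_def using ge1 by (intro continuous_on_divide continuous_on_const) force+
    ultimately show ?thesis unfolding F_def w_def
      by (intro continuous_on_add continuous_on_mult continuous_on_diff continuous_on_const
          continuous_on_id continuous_on_wave)
  qed
  obtain l where l: "0 \<le> l" "F l = 0"
    using IVT2'[of F \<beta> 0 0] F0 F\<beta> \<beta>0 cont by auto
  with F0 have l0: "l > 0" by (cases "l = 0") auto
  define \<Phi> where "\<Phi> = (\<lambda>x::int. profile (a l) (q l) n (nat \<bar>x\<bar>))"
  define \<psi> where "\<psi> = (\<lambda>x. complex_of_real (\<Phi> x))"
  have pos: "\<Phi> x > 0" for x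
    unfolding \<Phi>_def by (rule profile_pos[OF a2[OF l(1)] q0[OF l(1)] q1[OF l(1)]])
  have "\<psi> \<in> l2"
  proof (rule l2_dominated[OF l2_power_abs[OF q0[OF l(1)] q_less[OF l0]]])
    show "wave (a l) (q l) n / q l ^ n \<ge> 0"
      using w1[OF l(1), of n] q0[OF l(1)] by (simp add: w_def)
    show "cmod (\<psi> x) \<le> wave (a l) (q l) n / q l ^ n * cmod (complex_of_real (q l ^ nat \<bar>x\<bar>))" for x
      using profile_le[OF a2[OF l(1)] q0[OF l(1)] q1[OF l(1)], of n "nat \<bar>x\<bar>"] pos[of x] q0[OF l(1)]
      by (simp add: \<psi>_def \<Phi>_def norm_power)
  qed
  moreover have "\<psi> \<noteq> (\<lambda>x. 0)"
  proof
    assume "\<psi> = (\<lambda>x. 0)"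
    then have "\<psi> 0 = 0" by simp
    then show False using pos[of 0] by (simp add: \<psi>_def)
  qed
  moreover have "schroedinger \<kappa> (potential \<beta> b0 n) \<psi> = (\<lambda>x. complex_of_real l * \<psi> x)"
  proof
    fix x
    have "\<kappa> / 2 * (\<Phi> (x + 1) + \<Phi> (x - 1)) + (potential \<beta> b0 n x - \<kappa>) * \<Phi> x - l * \<Phi> x = 0"
      using schroedinger_profile[OF \<kappa> n q0[OF l(1)] qt[OF l(1), unfolded t_def], of b0 x \<beta>] l(2)
      unfolding \<Phi>_def a_def F_def w_def by (simp split: if_splits)
    then have "\<kappa> / 2 * \<Phi> (x + 1) + (\<kappa> / 2 * \<Phi> (x + -1) + (potential \<beta> b0 n x - \<kappa>) * \<Phi> x) = l * \<Phi> x"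
      by (simp add: algebra_simps)
    then show "schroedinger \<kappa> (potential \<beta> b0 n) \<psi> x = complex_of_real l * \<psi> x"
      unfolding schroedinger_eq \<psi>_def by (simp only: flip: of_real_mult of_real_add)
  qed
  ultimately show ?ev using l0 unfolding op_eigenvalue_def by blast
qed

section \<open>Closed form of the threshold\<close>

text \<open>Both sides satisfy the recurrence with characteristic polynomial
  \<open>x\<^sup>2 - (1 + 2 * s) * x + s\<^sup>2\<close>, whose roots are \<open>lam1\<close> and
  \<open>lam2\<close>, and agree at \<open>k = 0\<close> and \<open>k = 1\<close>.\<close>

lemma wave_closed_form:
  fixes s :: real
  defines "r \<equiv> sqrt (1 + 4 * s)"
  defines "lam1 \<equiv> ((1 + 2 * s) + r) / 2" and "lam2 \<equiv> ((1 + 2 * s) - r) / 2"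
  assumes s: "s > 0"
    and c1: "c1 * lam1 + c2 * lam2 = 1 + s"
    and c2: "c1 * lam1\<^sup>2 + c2 * lam2\<^sup>2 = 1 + 3 * s + s\<^sup>2"
  shows "c1 * lam1 ^ k + c2 * lam2 ^ k = s ^ k * wave (2 + 1 / s) 1 k"
proof -
  have r: "r\<^sup>2 = 1 + 4 * s" using s by (simp add: r_def)
  have lam1: "lam1\<^sup>2 = (1 + 2 * s) * lam1 - s\<^sup>2" and lam2: "lam2\<^sup>2 = (1 + 2 * s) * lam2 - s\<^sup>2"
    using r unfolding lam1_def lam2_def by (auto simp: power2_eq_square field_simps)
  \<comment> \<open>The constants are prescribed through exponents 1 and 2; running the recurrence
    backwards recovers the value at exponent 0.\<close>
  have "s\<^sup>2 * (c1 + c2) = (1 + 2 * s) * (c1 * lam1 + c2 * lam2) - (c1 * lam1\<^sup>2 + c2 * lam2\<^sup>2)"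
    unfolding lam1 lam2 by (simp add: algebra_simps)
  also have "\<dots> = s\<^sup>2 * 1" unfolding c1 c2 by (simp add: power2_eq_square algebra_simps)
  finally have c0: "c1 + c2 = 1" using s by simp
  show ?thesis
  proof (induction k rule: less_induct)
    case (less k)
    consider "k = 0" | "k = 1" | j where "k = Suc (Suc j)" by (metis One_nat_def not0_implies_Suc)
    then show ?case
    proof cases
      case 1
      then show ?thesis using c0 by simp
    next
      case 2
      then show ?thesis using c1 s by (simp add: field_simps)
    next
      case 3
      have "c1 * lam1 ^ k + c2 * lam2 ^ k = c1 * lam1 ^ j * lam1\<^sup>2 + c2 * lam2 ^ j * lam2\<^sup>2"
        by (simp add: 3 power2_eq_square)
      also have "\<dots> = (1 + 2 * s) * (c1 * lam1 ^ Suc j + c2 * lam2 ^ Suc j)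
          - s\<^sup>2 * (c1 * lam1 ^ j + c2 * lam2 ^ j)"
        unfolding lam1 lam2 by (simp add: algebra_simps)
      also have "\<dots> = (1 + 2 * s) * (s ^ Suc j * wave (2 + 1 / s) 1 (Suc j))
          - s\<^sup>2 * (s ^ j * wave (2 + 1 / s) 1 j)"
        using less[of "Suc j"] less[of j] 3 by simp
      also have "1 + 2 * s = s * (2 + 1 / s)" using s by (simp add: field_simps)
      also have "s * (2 + 1 / s) * (s ^ Suc j * wave (2 + 1 / s) 1 (Suc j))
          - s\<^sup>2 * (s ^ j * wave (2 + 1 / s) 1 j) = s ^ k * wave (2 + 1 / s) 1 k"
        by (simp add: 3 power2_eq_square algebra_simps)
      finally show ?thesis .
    qed
  qed
qed

theorem theorem2p2:
  fixes b :: "nat \<Rightarrow> real" and \<kappa> \<beta> b0 lam1 lam2 c1 c2 :: real and n :: nat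
  assumes "branching_law b" and "\<beta> = branching_intensity b" and "b0 = b 0"
    and "\<kappa> > 0" and "n \<ge> 1"
    and "lam1 = ((1 + \<kappa> / b0) + sqrt (1 + 2 * \<kappa> / b0)) / 2"
    and "lam2 = ((1 + \<kappa> / b0) - sqrt (1 + 2 * \<kappa> / b0)) / 2"
    and "c1 * lam1 + c2 * lam2 = 1 + \<kappa> / (2 * b0)"
    and "c1 * lam1\<^sup>2 + c2 * lam2\<^sup>2 = 1 + 3 * \<kappa> / (2 * b0) + \<kappa>\<^sup>2 / (4 * b0\<^sup>2)"
  shows "has_isolated_positive_eigenvalue (evolution_op \<kappa> \<beta> b0 n) \<longleftrightarrow>
     \<beta> > (\<kappa> * (c1 * lam1 ^ n + c2 * lam2 ^ n)
            - \<kappa>\<^sup>2 / (2 * b0) * (c1 * lam1 ^ (n - 1) + c2 * lam2 ^ (n - 1)))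
          / (c1 * lam1 ^ n + c2 * lam2 ^ n)"
proof -
  have b0: "b0 > 0" using assms(1,3) by (simp add: branching_law_def)
  \<comment> \<open>With this \<open>s\<close>, the coefficient \<open>2 + 1 / s\<close> is the
    interior coefficient \<open>2 * (1 + b0 / \<kappa>)\<close> at energy 0.\<close>
  define s where "s = \<kappa> / (2 * b0)"
  have s: "s > 0" using b0 assms(4) by (simp add: s_def)
  define W where "W = wave (2 + 1 / s) 1"
  have W: "W k \<ge> 1" for k using wave_mono_Suc[of "2 + 1 / s" 1 k] s by (simp add: W_def)
  have lam1: "lam1 = ((1 + 2 * s) + sqrt (1 + 4 * s)) / 2"
    and lam2: "lam2 = ((1 + 2 * s) - sqrt (1 + 4 * s)) / 2"
    using assms(6,7) by (simp_all add: s_def)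
  have closed: "c1 * lam1 ^ k + c2 * lam2 ^ k = s ^ k * W k" for k
    unfolding W_def lam1 lam2
  proof (rule wave_closed_form[OF s])
    show "c1 * (((1 + 2 * s) + sqrt (1 + 4 * s)) / 2) + c2 * (((1 + 2 * s) - sqrt (1 + 4 * s)) / 2) = 1 + s"
      using assms(8) unfolding lam1 lam2 by (simp add: s_def)
    show "c1 * (((1 + 2 * s) + sqrt (1 + 4 * s)) / 2)\<^sup>2 + c2 * (((1 + 2 * s) - sqrt (1 + 4 * s)) / 2)\<^sup>2
        = 1 + 3 * s + s\<^sup>2"
      using assms(9) unfolding lam1 lam2 by (simp add: s_def power_divide power_mult_distrib)
  qed
  have sn: "s ^ n = s * s ^ (n - 1)" using assms(5) by (simp add: power_eq_if)
  have \<kappa>s: "\<kappa>\<^sup>2 / (2 * b0) = \<kappa> * s" by (simp add: s_def power2_eq_square)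
  \<comment> \<open>The factor \<open>\<kappa>\<^sup>2 / (2 * b0) = \<kappa> * s\<close> supplies
    the power of \<open>s\<close> missing from exponent \<open>n - 1\<close>, so
    \<open>s ^ n\<close> cancels throughout.\<close>
  have "(\<kappa> * (s ^ n * W n) - \<kappa>\<^sup>2 / (2 * b0) * (s ^ (n - 1) * W (n - 1))) / (s ^ n * W n)
      = \<kappa> - \<kappa> * W (n - 1) / W n"
    unfolding \<kappa>s sn using s W[of n] by (simp add: field_simps)
  also have "\<dots> < \<beta> \<longleftrightarrow> \<kappa> * W (n - 1) + (\<beta> - \<kappa>) * W n > 0"
    using W[of n] by (simp add: field_simps)
  finally have thr: "\<beta> > (\<kappa> * (s ^ n * W n) - \<kappa>\<^sup>2 / (2 * b0) * (s ^ (n - 1) * W (n - 1))) / (s ^ n * W n)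
      \<longleftrightarrow> \<kappa> * W (n - 1) + (\<beta> - \<kappa>) * W n > 0" .
  have "finite {x. potential \<beta> b0 n x \<noteq> 0}"
    by (rule finite_subset[of _ "{- int n..int n}"]) (auto simp: potential_def)
  moreover have "potential \<beta> b0 n x \<le> 0" if "x \<noteq> 0" for x
    using that b0 by (simp add: potential_def)
  ultimately have "has_isolated_positive_eigenvalue (evolution_op \<kappa> \<beta> b0 n) \<longleftrightarrow>
      (\<exists>l>0. op_eigenvalue (schroedinger \<kappa> (potential \<beta> b0 n)) (complex_of_real l))"
    unfolding evolution_op_eq by (rule isolated_positive_eigenvalue_iff[OF _ _ assms(4)])
  also have "\<dots> \<longleftrightarrow> \<kappa> * W (n - 1) + (\<beta> - \<kappa>) * W n > 0"
  proof -
    have "2 * (1 + (b0 + 0) / \<kappa>) = 2 + 1 / s" by (simp add: s_def field_simps)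
    then show ?thesis
      using positive_eigenvalue_iff[OF assms(4) b0 assms(5), of \<beta>] by (simp add: W_def)
  qed
  finally show ?thesis unfolding closed thr .
qed

end
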